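(* Let $\mu,\nu>-1$, $0\le\theta\le\pi$ and $\alpha\in\mathbb{R}$, and let $P_n$ be the monic polynomials corresponding to $H_n^{(\mu,\nu)}(z;\alpha,\theta)$, with $\{x_k,\ k\in\mathbb{N}\}$ the spectrum of the associated Jacobi matrix $J$ (all as given in the context). Then there exists an entire function $Q$ such that $$\lim_{n\to\infty} z^n P_n(1/z) = Q(z),$$ uniformly on compact subsets of $\mathbb{C}$. The function $Q$ has infinitely many zeros at the points $\{1/x_k,\ k\in\mathbb{N}\}$.
   Context: The polynomials $H_n=H_n^{(\mu,\nu)}(z;\alpha,\theta)$, with $0\le\theta\le\pi$, $\mu,\nu>-1$ and $\alpha\in\mathbb{R}$, form a four-parameter family of orthogonal polynomials defined by $H_{-1}=0$, $H_0=1$ and $$\cos\theta\, H_n = \left( z\sin\theta\left[\left(n+\tfrac{\mu+\nu+1}{2}\right)^2+\alpha\right] + \frac{\nu^2-\mu^2}{(2n+\mu+\nu)(2n+\mu+\nu+2)}\right)H_n + \frac{2(n+\mu)(n+\nu)}{(2n+\mu+\nu)(2n+\mu+\nu+1)}H_{n-1} + \frac{2(n+1)(n+\mu+\nu+1)}{(2n+\mu+\nu+1)(2n+\mu+\nu+2)}H_{n+1}.$$ The monic polynomials are $P_n(z)=H_n^{(\mu,\nu)}(z;\alpha,\theta)/k_n$, where $k_n$ is the leading coefficient of $H_n$. They satisfy $$zP_n(z)=P_{n+1}(z)+b_nP_n(z)+a_n^2P_{n-1}(z),$$ with recurrence coefficients $$a_n^2=\frac{4n(n+\mu)(n+\nu)(n+\mu+\nu)}{\sin^2\theta\left[\left(n+\frac{\mu+\nu+1}{2}\right)^2+\alpha\right]\left[\left(n+\frac{\mu+\nu-1}{2}\right)^2+\alpha\right](2n+\mu+\nu+1)(2n+\mu+\nu)^2(2n+\mu+\nu-1)},$$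 $$b_n=\frac{1}{\sin\theta\left[\left(n+\frac{\mu+\nu+1}{2}\right)^2+\alpha\right]}\left(\cos\theta+\frac{\mu^2-\nu^2}{(2n+\mu+\nu)(2n+\mu+\nu+2)}\right).$$ The Jacobi matrix $J$ is the infinite symmetric tridiagonal matrix with diagonal entries $b_0,b_1,b_2,\dots$ and off-diagonal entries $a_1,a_2,a_3,\dots$. It is a compact (in fact trace class) operator, and its spectrum is a countable set $\{x_k,\ k\in\mathbb{N}\}$ with one accumulation point at $0$, so that $\lim_{k\to\infty}x_k=0$.
   Formalization: It is assumed that sin θ ≠ 0 and (n+(μ+ν+1)/2)²+α ≠ 0 for all n ≥ 0, since otherwise a_n², b_n and hence J are undefined; the points 1/x_k are taken over the nonzero points of the spectrum. *)

theory Defs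
  imports "HOL-Complex_Analysis.Complex_Analysis"
    "HOL-Computational_Algebra.Computational_Algebra"
begin

section \<open>The polynomials $H_n$ and their monic versions $P_n$\<close>

definition quad :: "real \<Rightarrow> real \<Rightarrow> real \<Rightarrow> nat \<Rightarrow> real" where
  "quad \<mu> \<nu> \<alpha> n = (real n + (\<mu> + \<nu> + 1) / 2)\<^sup>2 + \<alpha>"

text \<open>
  The three-term recurrence for $H_n$ reads
  \[ \cos\theta\, H_n = (z \sin\theta\, q_n + m_n) H_n + d_n H_{n-1} + u_n H_{n+1} \]
  with $q_n$, $m_n$, $d_n$, $u_n$ given by \<open>quad\<close>, \<open>H_mid\<close>, \<open>H_down\<close>, \<open>H_up\<close>.
  For $n = 0$ the general formulas are of the form $0/0$ when $\mu+\nu = 0$ or $\mu+\nu = -1$;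
  as usual the common factor is cancelled, which is what the \<open>n = 0\<close> branches spell out.
  The value \<open>H_down \<mu> \<nu> 0\<close> is irrelevant, since it multiplies $H_{-1} = 0$.
\<close>

definition H_mid :: "real \<Rightarrow> real \<Rightarrow> nat \<Rightarrow> real" where
  "H_mid \<mu> \<nu> n =
     (if n = 0 then (\<nu> - \<mu>) / (\<mu> + \<nu> + 2)
      else (\<nu>\<^sup>2 - \<mu>\<^sup>2) / ((2 * real n + \<mu> + \<nu>) * (2 * real n + \<mu> + \<nu> + 2)))"

definition H_down :: "real \<Rightarrow> real \<Rightarrow> nat \<Rightarrow> real" where
  "H_down \<mu> \<nu> n =
     2 * (real n + \<mu>) * (real n + \<nu>) / ((2 * real n + \<mu> + \<nu>) * (2 * real n + \<mu> + \<nu> + 1))"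

definition H_up :: "real \<Rightarrow> real \<Rightarrow> nat \<Rightarrow> real" where
  "H_up \<mu> \<nu> n =
     (if n = 0 then 2 / (\<mu> + \<nu> + 2)
      else 2 * (real n + 1) * (real n + \<mu> + \<nu> + 1) /
             ((2 * real n + \<mu> + \<nu> + 1) * (2 * real n + \<mu> + \<nu> + 2)))"

text \<open>The recurrence solved for its highest term, with $H_{-1} = 0$ and $H_0 = 1$.\<close>

fun H :: "real \<Rightarrow> real \<Rightarrow> real \<Rightarrow> real \<Rightarrow> nat \<Rightarrow> complex poly" where
  "H \<mu> \<nu> \<alpha> \<theta> 0 = 1"
| "H \<mu> \<nu> \<alpha> \<theta> (Suc 0) =
     smult (of_real (1 / H_up \<mu> \<nu> 0))
       [:of_real (cos \<theta> - H_mid \<mu> \<nu> 0), - of_real (sin \<theta> * quad \<mu> \<nu> \<alpha> 0):]"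
| "H \<mu> \<nu> \<alpha> \<theta> (Suc (Suc n)) =
     smult (of_real (1 / H_up \<mu> \<nu> (Suc n)))
       ([:of_real (cos \<theta> - H_mid \<mu> \<nu> (Suc n)), - of_real (sin \<theta> * quad \<mu> \<nu> \<alpha> (Suc n)):]
          * H \<mu> \<nu> \<alpha> \<theta> (Suc n)
        - smult (of_real (H_down \<mu> \<nu> (Suc n))) (H \<mu> \<nu> \<alpha> \<theta> n))"

definition P :: "real \<Rightarrow> real \<Rightarrow> real \<Rightarrow> real \<Rightarrow> nat \<Rightarrow> complex poly" where
  "P \<mu> \<nu> \<alpha> \<theta> n = smult (inverse (lead_coeff (H \<mu> \<nu> \<alpha> \<theta> n))) (H \<mu> \<nu> \<alpha> \<theta> n)"

text \<open>
  $z^n p(1/z)$ for a polynomial $p$ of degree at most $n$; the value at $z = 0$ is the one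
  making this expression a polynomial in $z$.
\<close>

definition reversed :: "nat \<Rightarrow> complex poly \<Rightarrow> complex \<Rightarrow> complex" where
  "reversed n p z = (if z = 0 then coeff p n else z ^ n * poly p (1 / z))"

section \<open>The Jacobi matrix\<close>

text \<open>
  Again common factors are cancelled where the general formula may be $0/0$, i.e. in $a_1^2$
  for $\mu+\nu = -1$ and in $b_0$ for $\mu+\nu = 0$. The argument \<open>n = 0\<close> of \<open>a_sq\<close> is not used.
\<close>

definition a_sq :: "real \<Rightarrow> real \<Rightarrow> real \<Rightarrow> real \<Rightarrow> nat \<Rightarrow> real" where
  "a_sq \<mu> \<nu> \<alpha> \<theta> n =
     (if n = 1 then
        4 * (1 + \<mu>) * (1 + \<nu>) /
          ((sin \<theta>)\<^sup>2 * quad \<mu> \<nu> \<alpha> 1 * quad \<mu> \<nu> \<alpha> 0 * (3 + \<mu> + \<nu>) * (2 + \<mu> + \<nu>)\<^sup>2)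
      else
        4 * real n * (real n + \<mu>) * (real n + \<nu>) * (real n + \<mu> + \<nu>) /
          ((sin \<theta>)\<^sup>2 * quad \<mu> \<nu> \<alpha> n * quad \<mu> \<nu> \<alpha> (n - 1) *
           (2 * real n + \<mu> + \<nu> + 1) * (2 * real n + \<mu> + \<nu>)\<^sup>2 * (2 * real n + \<mu> + \<nu> - 1)))"

definition b :: "real \<Rightarrow> real \<Rightarrow> real \<Rightarrow> real \<Rightarrow> nat \<Rightarrow> real" where
  "b \<mu> \<nu> \<alpha> \<theta> n =
     1 / (sin \<theta> * quad \<mu> \<nu> \<alpha> n) *
       (cos \<theta> +
         (if n = 0 then (\<mu> - \<nu>) / (\<mu> + \<nu> + 2)
          else (\<mu>\<^sup>2 - \<nu>\<^sup>2) / ((2 * real n + \<mu> + \<nu>) * (2 * real n + \<mu> + \<nu> + 2))))"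

text \<open>
  If $\alpha$ is sufficiently negative, finitely many of the $a_n^2$ are negative; hence the complex
  square root, which is the usual nonnegative one when $a_n^2 \ge 0$. The matrix is then still
  symmetric, but not Hermitian.
\<close>

definition a :: "real \<Rightarrow> real \<Rightarrow> real \<Rightarrow> real \<Rightarrow> nat \<Rightarrow> complex" where
  "a \<mu> \<nu> \<alpha> \<theta> n = csqrt (of_real (a_sq \<mu> \<nu> \<alpha> \<theta> n))"

definition J :: "real \<Rightarrow> real \<Rightarrow> real \<Rightarrow> real \<Rightarrow> nat \<Rightarrow> nat \<Rightarrow> complex" where
  "J \<mu> \<nu> \<alpha> \<theta> i j =
     (if i = j then of_real (b \<mu> \<nu> \<alpha> \<theta> i)
      else if j = Suc i then a \<mu> \<nu> \<alpha> \<theta> j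
      else if i = Suc j then a \<mu> \<nu> \<alpha> \<theta> i
      else 0)"

section \<open>Spectrum of an infinite matrix on $\ell^2$\<close>

definition l2 :: "(nat \<Rightarrow> complex) set" where
  "l2 = {u. summable (\<lambda>n. (cmod (u n))\<^sup>2)}"

definition l2_norm :: "(nat \<Rightarrow> complex) \<Rightarrow> real" where
  "l2_norm u = sqrt (\<Sum>n. (cmod (u n))\<^sup>2)"

definition mat_apply :: "(nat \<Rightarrow> nat \<Rightarrow> complex) \<Rightarrow> (nat \<Rightarrow> complex) \<Rightarrow> nat \<Rightarrow> complex" where
  "mat_apply A u i = (\<Sum>j. A i j * u j)"

definition l2_shifted :: "(nat \<Rightarrow> nat \<Rightarrow> complex) \<Rightarrow> complex \<Rightarrow> (nat \<Rightarrow> complex) \<Rightarrow> nat \<Rightarrow> complex" where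
  "l2_shifted A x u = (\<lambda>i. mat_apply A u i - x * u i)"

text \<open>
  The complement of the set of $x$ for which $A - x$ is a bijection of $\ell^2$ with bounded inverse.
\<close>

definition l2_spectrum :: "(nat \<Rightarrow> nat \<Rightarrow> complex) \<Rightarrow> complex set" where
  "l2_spectrum A =
     {x. \<not> (bij_betw (l2_shifted A x) l2 l2 \<and>
            (\<exists>C. \<forall>u\<in>l2. l2_norm u \<le> C * l2_norm (l2_shifted A x u)))}"

section \<open>The recurrences\<close>

text \<open>The defining recurrence of $H_n$ in its original form.\<close>

lemma H_up_pos: assumes "\<mu> > -1" "\<nu> > -1" shows "H_up \<mu> \<nu> n > 0"
proof (cases n)
  case 0 then show ?thesis using assms by (simp add: H_up_def)
next
  case (Suc m)
  then have "real n \<ge> 1" by simp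
  then show ?thesis using assms Suc unfolding H_up_def
    by (auto intro!: divide_pos_pos mult_pos_pos)
qed

lemma H_recurrence:
  fixes z :: complex
  assumes "\<mu> > -1" and "\<nu> > -1" and "n \<ge> 1"
  shows "of_real (cos \<theta>) * poly (H \<mu> \<nu> \<alpha> \<theta> n) z =
    (z * of_real (sin \<theta> * ((real n + (\<mu> + \<nu> + 1) / 2)\<^sup>2 + \<alpha>)) +
     of_real ((\<nu>\<^sup>2 - \<mu>\<^sup>2) / ((2 * real n + \<mu> + \<nu>) * (2 * real n + \<mu> + \<nu> + 2)))) * poly (H \<mu> \<nu> \<alpha> \<theta> n) z
    + of_real (2 * (real n + \<mu>) * (real n + \<nu>) / ((2 * real n + \<mu> + \<nu>) * (2 * real n + \<mu> + \<nu> + 1)))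
      * poly (H \<mu> \<nu> \<alpha> \<theta> (n - 1)) z
    + of_real (2 * (real n + 1) * (real n + \<mu> + \<nu> + 1) / ((2 * real n + \<mu> + \<nu> + 1) * (2 * real n + \<mu> + \<nu> + 2)))
      * poly (H \<mu> \<nu> \<alpha> \<theta> (n + 1)) z"
proof -
  obtain m where m: "n = Suc m" using assms(3) by (cases n) auto
  have up: "H_up \<mu> \<nu> n = 2 * (real n + 1) * (real n + \<mu> + \<nu> + 1) / ((2 * real n + \<mu> + \<nu> + 1) * (2 * real n + \<mu> + \<nu> + 2))"
    and mid: "H_mid \<mu> \<nu> n = (\<nu>\<^sup>2 - \<mu>\<^sup>2) / ((2 * real n + \<mu> + \<nu>) * (2 * real n + \<mu> + \<nu> + 2))"
    using m by (simp_all add: H_up_def H_mid_def)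
  have nz: "complex_of_real (H_up \<mu> \<nu> n) \<noteq> 0" using H_up_pos[OF assms(1,2), of n] by simp
  have eq: "complex_of_real (H_up \<mu> \<nu> n) * poly (H \<mu> \<nu> \<alpha> \<theta> (n+1)) z =
    (of_real (cos \<theta> - H_mid \<mu> \<nu> n) - z * of_real (sin \<theta> * quad \<mu> \<nu> \<alpha> n)) * poly (H \<mu> \<nu> \<alpha> \<theta> n) z
     - of_real (H_down \<mu> \<nu> n) * poly (H \<mu> \<nu> \<alpha> \<theta> (n - 1)) z"
    using nz by (simp add: m field_simps)
  show ?thesis
    unfolding up[symmetric] mid[symmetric] H_down_def[symmetric] quad_def[symmetric]
    unfolding eq by (simp add: algebra_simps)
qed

lemma H_recurrence_0:
  fixes z :: complex
  assumes "\<mu> > -1" and "\<nu> > -1" and "\<mu> + \<nu> \<noteq> 0" and "\<mu> + \<nu> \<noteq> - 1"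
  shows "of_real (cos \<theta>) * poly (H \<mu> \<nu> \<alpha> \<theta> 0) z =
    (z * of_real (sin \<theta> * (((\<mu> + \<nu> + 1) / 2)\<^sup>2 + \<alpha>)) +
     of_real ((\<nu>\<^sup>2 - \<mu>\<^sup>2) / ((\<mu> + \<nu>) * (\<mu> + \<nu> + 2)))) * poly (H \<mu> \<nu> \<alpha> \<theta> 0) z
    + of_real (2 * (\<mu> + \<nu> + 1) / ((\<mu> + \<nu> + 1) * (\<mu> + \<nu> + 2))) * poly (H \<mu> \<nu> \<alpha> \<theta> 1) z"
proof -
  have "(\<nu>\<^sup>2 - \<mu>\<^sup>2) = (\<nu> - \<mu>) * (\<mu> + \<nu>)" by (simp add: power2_eq_square algebra_simps)
  then have mid: "(\<nu>\<^sup>2 - \<mu>\<^sup>2) / ((\<mu> + \<nu>) * (\<mu> + \<nu> + 2)) = H_mid \<mu> \<nu> 0"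
    using assms by (simp add: H_mid_def)
  have up: "2 * (\<mu> + \<nu> + 1) / ((\<mu> + \<nu> + 1) * (\<mu> + \<nu> + 2)) = H_up \<mu> \<nu> 0"
  proof -
    have "\<mu> + \<nu> + 1 \<noteq> 0" "\<mu> + \<nu> + 2 \<noteq> 0" using assms by auto
    then show ?thesis by (simp add: H_up_def divide_simps)
  qed
  have nz: "complex_of_real (H_up \<mu> \<nu> 0) \<noteq> 0" using H_up_pos[OF assms(1,2), of 0] by simp
  have q: "((\<mu> + \<nu> + 1) / 2)\<^sup>2 + \<alpha> = quad \<mu> \<nu> \<alpha> 0" by (simp add: quad_def)
  show ?thesis unfolding up mid q using nz by (simp add: field_simps)
qed

lemma H_deg_lc:
  "degree (H \<mu> \<nu> \<alpha> \<theta> n) \<le> n \<and>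
   coeff (H \<mu> \<nu> \<alpha> \<theta> n) n = (\<Prod>k<n. of_real (- (sin \<theta> * quad \<mu> \<nu> \<alpha> k) / H_up \<mu> \<nu> k))"
proof (induction \<mu> \<nu> \<alpha> \<theta> n rule: H.induct)
  case (3 \<mu> \<nu> \<alpha> \<theta> n)
  let ?l = "[:of_real (cos \<theta> - H_mid \<mu> \<nu> (Suc n)), - of_real (sin \<theta> * quad \<mu> \<nu> \<alpha> (Suc n)):] :: complex poly"
  have c0: "coeff (H \<mu> \<nu> \<alpha> \<theta> n) (Suc (Suc n)) = 0" "coeff (H \<mu> \<nu> \<alpha> \<theta> (Suc n)) (Suc (Suc n)) = 0"
    using 3 by (auto intro!: coeff_eq_0)
  have "degree ?l \<le> 1" by simp
  then have "degree (?l * H \<mu> \<nu> \<alpha> \<theta> (Suc n)) \<le> Suc (Suc n)"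
    using 3 degree_mult_le[of ?l "H \<mu> \<nu> \<alpha> \<theta> (Suc n)"] by linarith
  moreover have "degree (smult (of_real (H_down \<mu> \<nu> (Suc n))) (H \<mu> \<nu> \<alpha> \<theta> n)) \<le> Suc (Suc n)"
    using 3 degree_smult_le[of "of_real (H_down \<mu> \<nu> (Suc n))" "H \<mu> \<nu> \<alpha> \<theta> n"] by linarith
  ultimately have "degree (?l * H \<mu> \<nu> \<alpha> \<theta> (Suc n) - smult (of_real (H_down \<mu> \<nu> (Suc n))) (H \<mu> \<nu> \<alpha> \<theta> n)) \<le> Suc (Suc n)"
    by (rule degree_diff_le)
  then have "degree (H \<mu> \<nu> \<alpha> \<theta> (Suc (Suc n))) \<le> Suc (Suc n)"
    unfolding H.simps using degree_smult_le order_trans by blast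
  moreover have "coeff (H \<mu> \<nu> \<alpha> \<theta> (Suc (Suc n))) (Suc (Suc n)) =
      of_real (- (sin \<theta> * quad \<mu> \<nu> \<alpha> (Suc n)) / H_up \<mu> \<nu> (Suc n)) * coeff (H \<mu> \<nu> \<alpha> \<theta> (Suc n)) (Suc n)"
    using c0 by simp
  ultimately show ?case using 3 by (simp add: mult_ac)
qed auto

text \<open>The recurrence of the monic polynomials with the coefficients of the Jacobi matrix.\<close>

lemma P_recurrence:
  assumes "\<mu> > -1" and "\<nu> > -1" and "sin \<theta> \<noteq> 0" and q: "\<And>n. quad \<mu> \<nu> \<alpha> n \<noteq> 0"
  shows "z * poly (P \<mu> \<nu> \<alpha> \<theta> 0) z = poly (P \<mu> \<nu> \<alpha> \<theta> 1) z + of_real (b \<mu> \<nu> \<alpha> \<theta> 0) * poly (P \<mu> \<nu> \<alpha> \<theta> 0) z"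
  and "z * poly (P \<mu> \<nu> \<alpha> \<theta> (Suc n)) z = poly (P \<mu> \<nu> \<alpha> \<theta> (Suc (Suc n))) z
     + of_real (b \<mu> \<nu> \<alpha> \<theta> (Suc n)) * poly (P \<mu> \<nu> \<alpha> \<theta> (Suc n)) z
     + of_real (a_sq \<mu> \<nu> \<alpha> \<theta> (Suc n)) * poly (P \<mu> \<nu> \<alpha> \<theta> n) z"
proof -
  define k where "k n = (\<Prod>k<n. - (sin \<theta> * quad \<mu> \<nu> \<alpha> k) / H_up \<mu> \<nu> k)" for n
  have up: "H_up \<mu> \<nu> n > 0" for n using H_up_pos assms by blast
  have knz: "k n \<noteq> 0" for n unfolding k_def using assms up by (auto simp: less_imp_neq[symmetric] dest: less_imp_neq)
  have co: "coeff (H \<mu> \<nu> \<alpha> \<theta> n) n = of_real (k n)" for n using H_deg_lc by (simp add: k_def)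
  have deg: "degree (H \<mu> \<nu> \<alpha> \<theta> n) = n" for n
    using co[of n] knz[of n] H_deg_lc[of \<mu> \<nu> \<alpha> \<theta> n] by (metis le_antisym le_degree of_real_eq_0_iff)
  have PH: "poly (P \<mu> \<nu> \<alpha> \<theta> n) z = poly (H \<mu> \<nu> \<alpha> \<theta> n) z / of_real (k n)" for n
    unfolding P_def deg co by (simp add: field_simps)
  have kS: "k (Suc n) = - (sin \<theta> * quad \<mu> \<nu> \<alpha> n) / H_up \<mu> \<nu> n * k n" for n by (simp add: k_def)
  have bm: "b \<mu> \<nu> \<alpha> \<theta> n = (cos \<theta> - H_mid \<mu> \<nu> n) / (sin \<theta> * quad \<mu> \<nu> \<alpha> n)" for n
    unfolding b_def H_mid_def by (simp add: minus_divide_left)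
  have am: "a_sq \<mu> \<nu> \<alpha> \<theta> (Suc n) = H_down \<mu> \<nu> (Suc n) * H_up \<mu> \<nu> n / ((sin \<theta>)\<^sup>2 * quad \<mu> \<nu> \<alpha> (Suc n) * quad \<mu> \<nu> \<alpha> n)" for n
  proof (cases n)
    case 0
    have "H_down \<mu> \<nu> 1 * H_up \<mu> \<nu> 0 = 4 * (1 + \<mu>) * (1 + \<nu>) / ((3 + \<mu> + \<nu>) * (2 + \<mu> + \<nu>)\<^sup>2)"
      unfolding H_down_def H_up_def using assms by (simp add: field_simps power2_eq_square)
    then show ?thesis by (simp add: 0 a_sq_def mult.assoc mult.commute mult.left_commute)
  next
    case (Suc m)
    define N where "N = real m + 2"
    have N: "real (Suc n) = N" "real n = N - 1" by (simp_all add: N_def Suc)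
    have Nge: "N \<ge> 2" by (simp add: N_def)
    have nz: "2 * N + \<mu> + \<nu> \<noteq> 0" "2 * N + \<mu> + \<nu> + 1 \<noteq> 0" "2 * N + \<mu> + \<nu> - 1 \<noteq> 0" using Nge assms by auto
    have "n \<noteq> 0" using Suc by simp
    then have U: "H_up \<mu> \<nu> n = 2 * N * (N + \<mu> + \<nu>) / ((2 * N + \<mu> + \<nu> - 1) * (2 * N + \<mu> + \<nu>))"
      unfolding H_up_def N by (simp add: algebra_simps)
    have "H_down \<mu> \<nu> (Suc n) * H_up \<mu> \<nu> n = 4 * N * (N + \<mu>) * (N + \<nu>) * (N + \<mu> + \<nu>) / ((2 * N + \<mu> + \<nu> + 1) * (2 * N + \<mu> + \<nu>)\<^sup>2 * (2 * N + \<mu> + \<nu> - 1))"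
      unfolding H_down_def U N times_divide_times_eq
      by (rule arg_cong2[where f="(/)"]; simp add: power2_eq_square algebra_simps)
    then show ?thesis using \<open>n \<noteq> 0\<close> unfolding a_sq_def N by (simp add: mult.assoc mult.commute mult.left_commute)
  qed
  have c: "of_real (sin \<theta>) \<noteq> (0::complex)" "of_real (quad \<mu> \<nu> \<alpha> n) \<noteq> (0::complex)" "of_real (H_up \<mu> \<nu> n) \<noteq> (0::complex)" "of_real (k n) \<noteq> (0::complex)" for n
    using assms up[of n] knz by auto
  have k0: "k 0 = 1" by (simp add: k_def)
  show "z * poly (P \<mu> \<nu> \<alpha> \<theta> 0) z = poly (P \<mu> \<nu> \<alpha> \<theta> 1) z + of_real (b \<mu> \<nu> \<alpha> \<theta> 0) * poly (P \<mu> \<nu> \<alpha> \<theta> 0) z"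
    unfolding PH bm One_nat_def kS k0 using c(1) c(2-4)[of 0] by (simp add: field_simps)
  show "z * poly (P \<mu> \<nu> \<alpha> \<theta> (Suc n)) z = poly (P \<mu> \<nu> \<alpha> \<theta> (Suc (Suc n))) z
     + of_real (b \<mu> \<nu> \<alpha> \<theta> (Suc n)) * poly (P \<mu> \<nu> \<alpha> \<theta> (Suc n)) z
     + of_real (a_sq \<mu> \<nu> \<alpha> \<theta> (Suc n)) * poly (P \<mu> \<nu> \<alpha> \<theta> n) z"
    unfolding PH bm am kS using c(1) c(2-4)[of n] c(2-4)[of "Suc n"] by (simp add: field_simps power2_eq_square)
qed

end

theory Submission
  imports Defs "HOL-Real_Asymp.Real_Asymp"
begin

text \<open>
  Put $q_n(z) = z^n P_n(1/z)$. The recurrence of the monic polynomials turns into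
  $q_{n+1} = (1 - b_n z) q_n - a_n^2 z^2 q_{n-1}$, so $q_n(z) = \det(1 - z J_n)$ with $J_n$ the
  leading $n \times n$ block of $J$. As $b_n$ and $a_n^2$ are $O(1/n^2)$, the increments
  $q_{n+1} - q_n$ are summable uniformly on discs, and the $q_n$ converge to an entire function $Q$,
  the Fredholm determinant of $1 - zJ$. The same holds with the first $k$ rows and columns of $J$
  deleted. The limits $Q_k$ (\<open>tail_det k\<close>, with $Q = Q_0$) tend to $1$ as $k$ grows and satisfy
  $Q_k = (1 - b_k z) Q_{k+1} - a_{k+1}^2 z^2 Q_{k+2}$ (\<open>tail_det_rec\<close>).

  \<^emph>\<open>Zeros and spectrum.\<close> The sequence $u_n = z^n a_1 \cdots a_n Q_{n+1}(z)$ decays faster than any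
  geometric sequence, and $J u - u/z$ is a multiple of $Q(z)$ times the first unit vector. If
  $Q(z) = 0$, then $u$ is an eigenvector. If $Q(z) \neq 0$, then $u$ and the solution
  $p_n = q_n(z) / (z^n a_1 \cdots a_n)$ that starts at the first row have Wronskian $Q(z)$, and
  Green's formula gives a kernel inverting $J - 1/z$ that decays exponentially away from the
  diagonal. A Schur test makes the inverse bounded, and $p$ is not square summable, so $J - 1/z$ is
  injective (\<open>spectrum_iff\<close>). Everything rests on the recurrence, so the argument covers negative
  $a_n^2$, for which $J$ is not self-adjoint.

  \<^emph>\<open>Infinitely many zeros.\<close> From some index $N$ on all $a_n^2$ are positive. For $k \ge N$ the quotient
  $R = z Q_{k+1}/Q_k$ maps the upper half-plane into itself and satisfies
  $|R(z)| \le |z|^2 / |\mathrm{Im}\, z|$ off the real axis (\<open>resolvent_bound\<close>), so the zeros of $Q_k$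
  are real, and they are simple. If there were finitely many of them, the bound would force $R$ to be
  a rational function; but $R$ has an infinite continued fraction
  (\<open>tail_det_ratio_not_rational\<close>). So $Q_k$ has infinitely many zeros. They are passed on to $Q$ by
  $Q = q_k Q_k - a_k^2 z^2 q_{k-1} Q_{k+1}$ (\<open>tail_det_split\<close>): far out on either half of the real
  line $q_{k-1}$ has constant sign, while $Q_{k+1}$ changes sign from one zero of $Q_k$
  to the next, and with it $Q$.
\<close>

section \<open>Entire functions and real zeros\<close>

text \<open>
  The bound is useless near the real axis. Multiplying $f$ by $z^2 - r^2$ repairs this, since
  $|z^2 - r^2| = 2 r |\mathrm{Im}\, z|$ on the circle $|z| = r$; the maximum principle then bounds $f$ on
  the circle of half the radius, where $z^2 - r^2$ is of size $r^2$.
\<close>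

lemma entire_bounded_off_axis_imp_poly:
  fixes f :: "complex \<Rightarrow> complex"
  assumes hol: "f holomorphic_on UNIV"
    and bd: "\<And>z. cmod z \<ge> R \<Longrightarrow> cmod (f z) * \<bar>Im z\<bar> \<le> C * cmod z ^ d"
  shows "\<exists>p. \<forall>z. f z = poly p z"
proof -
  have growth: "cmod (f w) \<le> 2 ^ (d + 1) * C * cmod w ^ d" if w: "cmod w \<ge> max R 1" for w
  proof -
    define r where "r = 2 * cmod w"
    have r: "r \<ge> R" "r > 0" "cmod w = r / 2" using w by (auto simp: r_def)
    have circ: "cmod (f z * (z\<^sup>2 - of_real (r\<^sup>2))) \<le> 2 * r * (C * r ^ d)" if z: "cmod z = r" for z
    proof -
      have "z\<^sup>2 - of_real (r\<^sup>2) = z * (z - cnj z)"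
        using complex_norm_square[of z] z by (simp add: power2_eq_square algebra_simps)
      also have "z - cnj z = of_real (2 * Im z) * \<i>" by (simp add: complex_eq_iff)
      finally have "cmod (z\<^sup>2 - of_real (r\<^sup>2)) = 2 * r * \<bar>Im z\<bar>" using z by (simp add: norm_mult)
      then have "cmod (f z * (z\<^sup>2 - of_real (r\<^sup>2))) = 2 * r * (cmod (f z) * \<bar>Im z\<bar>)"
        by (simp add: norm_mult)
      also have "\<dots> \<le> 2 * r * (C * r ^ d)"
        using bd[of z] z r by (intro mult_left_mono) auto
      finally show ?thesis .
    qed
    have "cmod (f w * (w\<^sup>2 - of_real (r\<^sup>2))) \<le> 2 * r * (C * r ^ d)"
    proof (rule maximum_modulus_frontier[where S = "cball 0 r" and f = "\<lambda>w. f w * (w\<^sup>2 - of_real (r\<^sup>2))"])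
      show "(\<lambda>w. f w * (w\<^sup>2 - of_real (r\<^sup>2))) holomorphic_on interior (cball 0 r)"
        by (intro holomorphic_intros holomorphic_on_subset[OF hol]) auto
      show "continuous_on (closure (cball 0 r)) (\<lambda>w. f w * (w\<^sup>2 - of_real (r\<^sup>2)))"
        by (intro continuous_intros continuous_on_subset[OF holomorphic_on_imp_continuous_on[OF hol]]) auto
    qed (use circ r in auto)
    moreover have "3 / 4 * r\<^sup>2 \<le> cmod (w\<^sup>2 - of_real (r\<^sup>2))"
      using norm_triangle_ineq2[of "of_real (r\<^sup>2)" "w\<^sup>2"] r(3)
      by (simp add: norm_power norm_minus_commute power_divide norm_mult)
    then have "cmod (f w) * (3 / 4 * r\<^sup>2) \<le> cmod (f w) * cmod (w\<^sup>2 - of_real (r\<^sup>2))"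
      by (rule mult_left_mono) simp
    ultimately have "cmod (f w) * (3 / 4 * r\<^sup>2) \<le> 2 * r * (C * r ^ d)"
      by (simp only: norm_mult)
    then have "r * (cmod (f w) * (3 / 4 * r)) \<le> r * (2 * (C * r ^ d))"
      by (simp add: power2_eq_square algebra_simps)
    then have *: "cmod (f w) * (3 / 4 * r) \<le> 2 * (C * r ^ d)" using r by simp
    have "cmod (f w) * 1 \<le> cmod (f w) * (3 / 4 * r)"
      using w by (intro mult_left_mono) (auto simp: r_def)
    also note *
    also have "2 * (C * r ^ d) = 2 ^ (d + 1) * C * cmod w ^ d" by (simp add: r_def power_mult_distrib)
    finally show ?thesis by simp
  qed
  have "f z = (\<Sum>k\<le>d. (deriv ^^ k) f 0 / fact k * z ^ k)" for z
    by (rule Liouville_polynomial[OF hol growth])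
  then show ?thesis
    by (intro exI[of _ "\<Sum>k\<le>d. monom ((deriv ^^ k) f 0 / fact k) k"]) (simp add: poly_sum poly_monom)
qed

text \<open>
  Simplicity makes the induction painless: dividing by $z - \zeta$ removes the zero $\zeta$ and
  keeps the derivative nonzero at the others.
\<close>

lemma entire_factor_simple_zeros:
  fixes g :: "complex \<Rightarrow> complex"
  assumes "finite Z" and "g holomorphic_on UNIV" and "\<And>z. g z = 0 \<longleftrightarrow> z \<in> Z"
    and "\<And>z. z \<in> Z \<Longrightarrow> deriv g z \<noteq> 0"
  shows "\<exists>e. e holomorphic_on UNIV \<and> (\<forall>z. e z \<noteq> 0) \<and> (\<forall>z. g z = (\<Prod>\<zeta>\<in>Z. z - \<zeta>) * e z)"
  using assms
proof (induction Z arbitrary: g rule: finite_induct)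
  case empty
  then show ?case by (intro exI[of _ g]) auto
next
  case (insert \<zeta> Z)
  define g1 where "g1 z = (if z = \<zeta> then deriv g \<zeta> else (g z - g \<zeta>) / (z - \<zeta>))" for z
  have g\<zeta>: "g \<zeta> = 0" using insert.prems by auto
  have hol: "g1 holomorphic_on UNIV"
    unfolding g1_def[abs_def] by (rule pole_lemma[OF insert.prems(1)]) auto
  have g_eq: "g z = (z - \<zeta>) * g1 z" for z using g\<zeta> by (simp add: g1_def)
  have zeros: "g1 z = 0 \<longleftrightarrow> z \<in> Z" for z
  proof (cases "z = \<zeta>")
    case True
    then show ?thesis using insert.prems(3)[of \<zeta>] insert.hyps(2) by (simp add: g1_def)
  next
    case False
    then have "g1 z = 0 \<longleftrightarrow> g z = 0" by (simp add: g_eq)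
    then show ?thesis using insert.prems(2)[of z] False by simp
  qed
  have "deriv g1 z \<noteq> 0" if "z \<in> Z" for z
  proof -
    have "(g1 has_field_derivative deriv g1 z) (at z)"
      using holomorphic_derivI[OF hol] by auto
    then have "((\<lambda>z. (z - \<zeta>) * g1 z) has_field_derivative 1 * g1 z + deriv g1 z * (z - \<zeta>)) (at z)"
      by (intro DERIV_mult derivative_eq_intros) auto
    moreover have "g = (\<lambda>z. (z - \<zeta>) * g1 z)" by (rule ext) (rule g_eq)
    ultimately have "deriv g z = g1 z + deriv g1 z * (z - \<zeta>)" by (simp add: DERIV_imp_deriv)
    moreover have "deriv g z \<noteq> 0" "g1 z = 0" using insert.prems(3)[of z] that zeros[of z] by auto
    ultimately show ?thesis by auto
  qed
  from insert.IH[OF hol zeros this] obtain e where "e holomorphic_on UNIV" "\<forall>z. e z \<noteq> 0" "\<forall>z. g1 z = (\<Prod>\<zeta>\<in>Z. z - \<zeta>) * e z"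
    by auto
  then show ?case using insert.hyps g_eq by (intro exI[of _ e]) auto
qed

text \<open>
  A function that crosses zero only upwards has to come down again before its next zero.
\<close>

lemma no_two_increasing_zeros:
  fixes g :: "real \<Rightarrow> real"
  assumes "x1 < x2" and "g x1 = 0" and "g x2 = 0"
    and fin: "finite {x \<in> {x1..x2}. g x = 0}"
    and der: "\<And>x. (g has_real_derivative g' x) (at x)"
    and inc: "\<And>x. x \<in> {x1..x2} \<Longrightarrow> g x = 0 \<Longrightarrow> g' x > 0"
  shows False
proof -
  let ?Z = "{x \<in> {x1<..x2}. g x = 0}"
  have finZ: "finite ?Z" by (rule finite_subset[OF _ fin]) auto
  have neZ: "?Z \<noteq> {}" using assms by auto
  define y where "y = Min ?Z"
  have y: "y \<in> ?Z" unfolding y_def using Min_in[OF finZ neZ] .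
  have none: "g x \<noteq> 0" if "x1 < x" "x < y" for x
    using Min_le[OF finZ, of x] that y unfolding y_def[symmetric] by fastforce
  \<comment> \<open>\<open>y\<close> is the first zero after \<open>x1\<close>; \<open>g\<close> is positive just after \<open>x1\<close> and negative just before \<open>y\<close>\<close>
  obtain d1 where d1: "d1 > 0" "\<And>h. 0 < h \<Longrightarrow> h < d1 \<Longrightarrow> g x1 < g (x1 + h)"
    using DERIV_pos_inc_right[OF der inc[of x1]] assms by auto
  obtain d2 where d2: "d2 > 0" "\<And>h. 0 < h \<Longrightarrow> h < d2 \<Longrightarrow> g (y - h) < g y"
    using DERIV_pos_inc_left[OF der inc[of y]] y by auto
  define m where "m = min (min d1 d2) (y - x1)"
  define h where "h = m / 3"
  have "0 < m" "m \<le> d1" "m \<le> d2" "m \<le> y - x1" using d1 d2 y by (auto simp: m_def)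
  then have h: "0 < h" "h < d1" "h < d2" "x1 + h < y - h" unfolding h_def by linarith+
  have "g (y - h) \<le> 0" "0 \<le> g (x1 + h)" using d1(2)[of h] d2(2)[of h] h y assms by auto
  then obtain x where "x1 + h \<le> x" "x \<le> y - h" "g x = 0"
    using IVT2'[of g "y - h" 0 "x1 + h"] h DERIV_continuous_on[of "{x1 + h..y - h}" g g'] der
    by (metis has_field_derivative_at_within less_eq_real_def)
  then show False using none[of x] h by auto
qed

lemma two_large_points_same_side:
  fixes X :: "real set"
  assumes "infinite X" and "\<And>M. finite {x \<in> X. \<bar>x\<bar> \<le> M}"
  obtains x1 x2 where "x1 \<in> X" "x2 \<in> X" "x1 < x2" "\<And>x. x \<in> {x1..x2} \<Longrightarrow> \<bar>x\<bar> > M"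
proof -
  let ?A = "{x \<in> X. x > M}" and ?B = "{x \<in> X. x < - M}"
  have "X \<subseteq> {x \<in> X. \<bar>x\<bar> \<le> M} \<union> ?A \<union> ?B" by auto
  then have "infinite ?A \<or> infinite ?B" using assms by (meson finite_UnI finite_subset)
  then obtain C where C: "C = ?A \<or> C = ?B" "infinite C" by blast
  obtain x where x: "x \<in> C" using C(2) by (metis ex_in_conv finite.emptyI)
  obtain y where y: "y \<in> C" "y \<noteq> x" using C(2) by (metis finite.emptyI finite.insertI finite_subset insertCI subsetI)
  show ?thesis
  proof (rule that[of "min x y" "max x y"])
    fix t assume "t \<in> {min x y..max x y}"
    then show "\<bar>t\<bar> > M" using x y C(1) by (auto simp: min_def max_def split: if_splits)
  qed (use x y C(1) in \<open>auto simp: min_def max_def split: if_splits\<close>)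
qed

section \<open>Truncated Fredholm determinants and their limits\<close>

text \<open>
  \<open>\<beta>\<close> is the diagonal of a tridiagonal matrix and \<open>\<gamma> n\<close> the product of the two entries that couple
  the indices \<open>n - 1\<close> and \<open>n\<close>; determinants depend on these entries only through that product.
\<close>

locale jacobi_coeffs =
  fixes \<beta> \<gamma> :: "nat \<Rightarrow> real"
  assumes summable_\<beta>: "summable (\<lambda>n. \<bar>\<beta> n\<bar>)"
    and summable_\<gamma>: "summable (\<lambda>n. \<bar>\<gamma> n\<bar>)"
    and \<gamma>_nonzero: "\<And>n. \<gamma> (Suc n) \<noteq> 0"
begin

text \<open>
  The determinant of $1 - zM$, where $M$ is the block of the tridiagonal matrix with the rows and
  columns $k, \dots, k + n - 1$, expanded along the last row.
\<close>

fun trunc :: "nat \<Rightarrow> nat \<Rightarrow> complex \<Rightarrow> complex" where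
  "trunc k 0 z = 1"
| "trunc k (Suc 0) z = 1 - of_real (\<beta> k) * z"
| "trunc k (Suc (Suc n)) z =
     (1 - of_real (\<beta> (k + Suc n)) * z) * trunc k (Suc n) z
       - of_real (\<gamma> (k + Suc n)) * z\<^sup>2 * trunc k n z"

definition tail_det :: "nat \<Rightarrow> complex \<Rightarrow> complex" where
  "tail_det k z = lim (\<lambda>n. trunc k n z)"

text \<open>
  For $|z| \le r$ this bounds the coefficients through which the row \<open>n\<close> enters the determinant.
\<close>

definition step_weight :: "real \<Rightarrow> nat \<Rightarrow> real" where
  "step_weight r n = \<bar>\<beta> n\<bar> * r + \<bar>\<gamma> n\<bar> * r\<^sup>2"

lemma step_weight_nonneg: "r \<ge> 0 \<Longrightarrow> step_weight r n \<ge> 0"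
  by (simp add: step_weight_def)

lemma summable_step_weight: "summable (step_weight r)"
  unfolding step_weight_def by (intro summable_add summable_mult2 summable_\<beta> summable_\<gamma>)

lemma summable_step_weight_shift: "summable (\<lambda>i. step_weight r (k + i))"
  using summable_ignore_initial_segment[OF summable_step_weight[of r], of k] by (simp add: add.commute)

lemma norm_step_le:
  assumes "cmod z \<le> r"
  shows "cmod (of_real (\<beta> n) * z) + cmod (of_real (\<gamma> n) * z\<^sup>2) \<le> step_weight r n"
  unfolding step_weight_def norm_mult norm_power norm_of_real
  using assms by (intro add_mono mult_left_mono power_mono) auto

lemma trunc_le_prod:
  assumes "cmod z \<le> r"
  shows "cmod (trunc k n z) \<le> (\<Prod>i<n. 1 + step_weight r (k + i))"
proof -
  have r: "r \<ge> 0" using assms norm_ge_zero order_trans by blast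
  show ?thesis
  proof (induction n rule: induct_nat_012)
    case 1
    have "cmod (1 - of_real (\<beta> k) * z) \<le> 1 + cmod (of_real (\<beta> k) * z)"
      using norm_triangle_ineq4[of 1 "of_real (\<beta> k) * z"] by simp
    also have "\<dots> \<le> 1 + step_weight r k" using norm_step_le[OF assms, of k] norm_ge_zero[of "of_real (\<gamma> k) * z\<^sup>2"] by linarith
    finally show ?case by simp
  next
    case (ge2 n)
    define j where "j = k + Suc n"
    let ?p = "\<lambda>n. \<Prod>i<n. 1 + step_weight r (k + i)"
    have p0: "?p m \<ge> 0" for m using step_weight_nonneg[OF r] by (intro prod_nonneg) (simp add: add_nonneg_nonneg)
    have pm: "?p n \<le> ?p (Suc n)"
      using p0[of n] step_weight_nonneg[OF r, of "k+n"] by (simp add: mult_le_cancel_left1)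
    have "cmod (trunc k (Suc (Suc n)) z) \<le>
        cmod (1 - of_real (\<beta> j) * z) * cmod (trunc k (Suc n) z) + cmod (of_real (\<gamma> j) * z\<^sup>2) * cmod (trunc k n z)"
      using norm_triangle_ineq4[of "(1 - of_real (\<beta> j) * z) * trunc k (Suc n) z" "of_real (\<gamma> j) * z\<^sup>2 * trunc k n z"]
      by (simp add: norm_mult j_def)
    also have "\<dots> \<le> (1 + cmod (of_real (\<beta> j) * z)) * ?p (Suc n) + cmod (of_real (\<gamma> j) * z\<^sup>2) * ?p (Suc n)"
      using ge2 pm norm_triangle_ineq4[of 1 "of_real (\<beta> j) * z"]
      by (intro add_mono mult_mono) auto
    also have "\<dots> = (1 + (cmod (of_real (\<beta> j) * z) + cmod (of_real (\<gamma> j) * z\<^sup>2))) * ?p (Suc n)"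
      by (simp add: algebra_simps)
    also have "\<dots> \<le> (1 + step_weight r j) * ?p (Suc n)"
      using norm_step_le[OF assms, of j] p0[of "Suc n"] by (intro mult_right_mono) auto
    finally show ?case by (simp add: j_def mult.commute)
  qed simp
qed

definition trunc_bound :: "real \<Rightarrow> real" where "trunc_bound r = exp (\<Sum>i. step_weight r i)"

lemma trunc_bounded:
  assumes "cmod z \<le> r"
  shows "cmod (trunc k n z) \<le> trunc_bound r"
proof -
  have r: "r \<ge> 0" using assms norm_ge_zero order_trans by blast
  have "cmod (trunc k n z) \<le> (\<Prod>i<n. 1 + step_weight r (k + i))" by (rule trunc_le_prod[OF assms])
  also have "\<dots> \<le> (\<Prod>i<n. exp (step_weight r (k + i)))"
    using step_weight_nonneg[OF r] by (intro prod_mono) (simp add: add_nonneg_nonneg)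
  also have "\<dots> = exp (\<Sum>i<n. step_weight r (k + i))" by (simp add: exp_sum)
  also have "(\<Sum>i<n. step_weight r (k + i)) = sum (step_weight r) {k..<k+n}"
    using sum.shift_bounds_nat_ivl[of "step_weight r" 0 k n] by (simp add: add.commute lessThan_atLeast0)
  also have "exp (sum (step_weight r) {k..<k+n}) \<le> trunc_bound r"
    unfolding trunc_bound_def using sum_le_suminf[OF summable_step_weight, of "{k..<k+n}" r] step_weight_nonneg[OF r] by simp
  finally show ?thesis by simp
qed

text \<open>
  The bound is uniform in \<open>z\<close> and depends on \<open>k\<close> only through a shift of a summable sequence. The
  first property gives locally uniform convergence in \<open>n\<close>, the second the limit for large \<open>k\<close>.
\<close>

lemma trunc_diff_le:
  assumes "cmod z \<le> r"
  shows "cmod (trunc k (Suc n) z - trunc k n z) \<le> trunc_bound r * step_weight r (k + n)"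
proof (cases n)
  case 0
  have r: "r \<ge> 0" using assms norm_ge_zero order_trans by blast
  have b: "trunc_bound r \<ge> 1" unfolding trunc_bound_def using suminf_nonneg[OF summable_step_weight] step_weight_nonneg[OF r] by simp
  have "cmod (of_real (\<beta> k) * z) \<le> step_weight r k" using norm_step_le[OF assms, of k] norm_ge_zero[of "of_real (\<gamma> k) * z\<^sup>2"] by linarith
  also have "\<dots> \<le> trunc_bound r * step_weight r k" using b step_weight_nonneg[OF r, of k] by (simp add: mult_le_cancel_right1)
  finally show ?thesis using 0 by (simp add: norm_mult)
next
  case (Suc m)
  have "cmod (trunc k (Suc n) z - trunc k n z) =
      cmod (- (of_real (\<beta> (k+n)) * z) * trunc k n z - of_real (\<gamma> (k+n)) * z\<^sup>2 * trunc k m z)"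
    unfolding Suc by (simp add: algebra_simps)
  also have "\<dots> \<le> cmod (of_real (\<beta> (k+n)) * z) * cmod (trunc k n z) + cmod (of_real (\<gamma> (k+n)) * z\<^sup>2) * cmod (trunc k m z)"
    using norm_triangle_ineq4[of "- (of_real (\<beta> (k+n)) * z) * trunc k n z" "of_real (\<gamma> (k+n)) * z\<^sup>2 * trunc k m z"]
    by (simp add: norm_mult)
  also have "\<dots> \<le> cmod (of_real (\<beta> (k+n)) * z) * trunc_bound r + cmod (of_real (\<gamma> (k+n)) * z\<^sup>2) * trunc_bound r"
    using trunc_bounded[OF assms] by (intro add_mono mult_left_mono) auto
  also have "\<dots> \<le> trunc_bound r * step_weight r (k+n)"
    using mult_left_mono[OF norm_step_le[OF assms, of "k+n"], of "trunc_bound r"]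
    by (simp add: trunc_bound_def algebra_simps)
  finally show ?thesis .
qed

lemma trunc_telescope: "(\<Sum>i<n. trunc k (Suc i) z - trunc k i z) = trunc k n z - 1"
  using sum_lessThan_telescope[of "\<lambda>i. trunc k i z" n] by simp

lemma uniform_limit_trunc: "uniform_limit (cball 0 r) (\<lambda>n z. trunc k n z) (tail_det k) sequentially"
proof -
  have "uniform_limit (cball 0 r) (\<lambda>n z. \<Sum>i<n. trunc k (Suc i) z - trunc k i z)
     (\<lambda>z. \<Sum>i. trunc k (Suc i) z - trunc k i z) sequentially"
    using trunc_diff_le
    by (intro Weierstrass_m_test[where M="\<lambda>n. trunc_bound r * step_weight r (k + n)"] summable_mult summable_step_weight_shift) auto
  then have "uniform_limit (cball 0 r) (\<lambda>n z. trunc k n z - 1)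
     (\<lambda>z. \<Sum>i. trunc k (Suc i) z - trunc k i z) sequentially"
    by (simp add: trunc_telescope)
  then have u: "uniform_limit (cball 0 r) (\<lambda>n z. (trunc k n z - 1) + 1)
     (\<lambda>z. (\<Sum>i. trunc k (Suc i) z - trunc k i z) + 1) sequentially"
    by (intro uniform_limit_intros)
  have lim: "(\<Sum>i. trunc k (Suc i) z - trunc k i z) + 1 = tail_det k z" if "z \<in> cball 0 r" for z
    using tendsto_uniform_limitI[OF u that] unfolding tail_det_def by (simp add: limI)
  show ?thesis
    by (rule iffD1[OF uniform_limit_cong' u]) (use lim in auto)
qed

lemma trunc_tendsto: "(\<lambda>n. trunc k n z) \<longlonglongrightarrow> tail_det k z"
  using tendsto_uniform_limitI[OF uniform_limit_trunc[where r="cmod z"], of z] by simp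

lemma holomorphic_trunc: "trunc k n holomorphic_on S"
proof (induction n rule: induct_nat_012)
  case (ge2 n)
  then show ?case unfolding trunc.simps[abs_def] by (intro holomorphic_intros)
next
  case 0
  show ?case unfolding trunc.simps[abs_def] by (intro holomorphic_intros)
next
  case 1
  show ?case unfolding One_nat_def trunc.simps[abs_def] by (intro holomorphic_intros)
qed

lemma holomorphic_tail_det: "tail_det k holomorphic_on S"
proof -
  have "tail_det k holomorphic_on UNIV"
  proof (rule holomorphic_uniform_sequence[OF open_UNIV holomorphic_trunc])
    fix x :: complex
    have "cball x 1 \<subseteq> cball 0 (cmod x + 1)"
    proof
      fix y assume "y \<in> cball x 1"
      then have "cmod (y - x) \<le> 1" by (simp add: dist_norm norm_minus_commute)
      then show "y \<in> cball 0 (cmod x + 1)" using norm_triangle_ineq[of "y - x" x] by simp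
    qed
    then have "uniform_limit (cball x 1) (\<lambda>n z. trunc k n z) (tail_det k) sequentially"
      using uniform_limit_on_subset[OF uniform_limit_trunc] by blast
    then show "\<exists>d>0. cball x d \<subseteq> UNIV \<and> uniform_limit (cball x d) (trunc k) (tail_det k) sequentially"
      by (intro exI[of _ 1]) auto
  qed
  then show ?thesis by (rule holomorphic_on_subset) auto
qed

lemma tail_det_bounded: "cmod z \<le> r \<Longrightarrow> cmod (tail_det k z) \<le> trunc_bound r"
  by (rule LIMSEQ_le_const2[OF tendsto_norm[OF trunc_tendsto]]) (auto intro: trunc_bounded)

lemma trunc_0 [simp]: "trunc k n 0 = 1"
  by (induction n rule: induct_nat_012) auto

lemma tail_det_0 [simp]: "tail_det k 0 = 1"
  using trunc_tendsto[of k 0] by (simp add: LIMSEQ_const_iff)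

lemma tail_det_minus_1_le: "cmod (tail_det k z - 1) \<le> trunc_bound (cmod z) * (\<Sum>i. step_weight (cmod z) (k + i))"
proof (rule LIMSEQ_le_const2[OF tendsto_norm[OF tendsto_diff[OF trunc_tendsto tendsto_const]]], intro exI[of _ 0] allI impI)
  fix n :: nat
  have "cmod (trunc k n z - 1) = cmod (\<Sum>i<n. trunc k (Suc i) z - trunc k i z)"
    by (simp add: trunc_telescope)
  also have "\<dots> \<le> (\<Sum>i<n. trunc_bound (cmod z) * step_weight (cmod z) (k + i))"
    by (intro sum_norm_le trunc_diff_le) auto
  also have "\<dots> = trunc_bound (cmod z) * (\<Sum>i<n. step_weight (cmod z) (k + i))" by (simp add: sum_distrib_left)
  also have "\<dots> \<le> trunc_bound (cmod z) * (\<Sum>i. step_weight (cmod z) (k + i))"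
    by (intro mult_left_mono sum_le_suminf summable_step_weight_shift) (auto simp: step_weight_nonneg trunc_bound_def)
  finally show "cmod (trunc k n z - 1) \<le> trunc_bound (cmod z) * (\<Sum>i. step_weight (cmod z) (k + i))" .
qed

lemma tail_det_tendsto_1: "(\<lambda>k. tail_det k z) \<longlonglongrightarrow> 1"
proof -
  have "(\<lambda>k. trunc_bound (cmod z) * (\<Sum>i. step_weight (cmod z) (i + k))) \<longlonglongrightarrow> trunc_bound (cmod z) * 0"
    by (intro tendsto_mult tendsto_const suminf_exist_split2 summable_step_weight)
  then have "(\<lambda>k. trunc_bound (cmod z) * (\<Sum>i. step_weight (cmod z) (k + i))) \<longlonglongrightarrow> 0" by (simp add: add.commute)
  then have "(\<lambda>k. tail_det k z - 1) \<longlonglongrightarrow> 0"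
    by (rule Lim_null_comparison[OF always_eventually[OF allI[OF tail_det_minus_1_le]]])
  then show ?thesis by (simp add: LIM_zero_iff)
qed

text \<open>
  Expansion of the determinant along the first row, where the definition uses the last one. This is
  the recurrence that survives the limit $n \to \infty$.
\<close>

lemma trunc_expand_first:
  "trunc k (Suc (Suc n)) z =
     (1 - of_real (\<beta> k) * z) * trunc (Suc k) (Suc n) z - of_real (\<gamma> (Suc k)) * z\<^sup>2 * trunc (Suc (Suc k)) n z"
proof (induction n rule: induct_nat_012)
  case (ge2 n)
  show ?case
    unfolding trunc.simps(3)[of k "Suc (Suc n)"] ge2 trunc.simps(3)[of "Suc k" "Suc n"] trunc.simps(3)[of "Suc (Suc k)" n]
    by (simp add: algebra_simps)
qed (simp_all add: algebra_simps power2_eq_square)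

lemma tail_det_rec:
  "tail_det k z =
     (1 - of_real (\<beta> k) * z) * tail_det (Suc k) z - of_real (\<gamma> (Suc k)) * z\<^sup>2 * tail_det (Suc (Suc k)) z"
proof (rule LIMSEQ_unique)
  show "(\<lambda>n. trunc k (Suc (Suc n)) z) \<longlonglongrightarrow> tail_det k z"
    by (intro LIMSEQ_Suc trunc_tendsto)
  show "(\<lambda>n. trunc k (Suc (Suc n)) z) \<longlonglongrightarrow> (1 - of_real (\<beta> k) * z) * tail_det (Suc k) z - of_real (\<gamma> (Suc k)) * z\<^sup>2 * tail_det (Suc (Suc k)) z"
    unfolding trunc_expand_first by (intro tendsto_intros LIMSEQ_Suc trunc_tendsto)
qed

text \<open>
  Laplace expansion along the rows up to \<open>n\<close>. It is also the Wronskian, independent of \<open>n\<close>, of the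
  two solutions of the three-term recurrence that are normalised at the two ends of the matrix.
\<close>

lemma tail_det_split:
  "tail_det 0 z = trunc 0 (Suc n) z * tail_det (Suc n) z
     - of_real (\<gamma> (Suc n)) * z\<^sup>2 * trunc 0 n z * tail_det (Suc (Suc n)) z"
proof (induction n)
  case 0
  show ?case using tail_det_rec[of 0 z] by simp
next
  case (Suc n)
  show ?case
    unfolding Suc trunc.simps(3)[of 0 n] tail_det_rec[of "Suc n" z] by (simp add: algebra_simps)
qed

lemma trunc_cnj: "trunc k n (cnj z) = cnj (trunc k n z)"
  by (induction n rule: induct_nat_012) auto

lemma tail_det_cnj: "tail_det k (cnj z) = cnj (tail_det k z)"
  using LIMSEQ_unique[OF trunc_tendsto[of k "cnj z"]] tendsto_cnj[OF trunc_tendsto[of k z]]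
  by (simp add: trunc_cnj)

lemma trunc_eq_poly: "\<exists>p. \<forall>z. trunc k n z = poly p z"
proof (induction n rule: induct_nat_012)
  case 0
  then show ?case by (intro exI[of _ 1]) auto
next
  case 1
  then show ?case by (intro exI[of _ "[:1, - of_real (\<beta> k):]"]) (auto simp: algebra_simps)
next
  case (ge2 n)
  then obtain p1 p2 where "\<forall>z. trunc k n z = poly p1 z" "\<forall>z. trunc k (Suc n) z = poly p2 z" by auto
  then show ?case
    by (intro exI[of _ "[:1, - of_real (\<beta> (k + Suc n)):] * p2 - [:0, 0, of_real (\<gamma> (k + Suc n)):] * p1"])
      (auto simp: algebra_simps power2_eq_square)
qed

section \<open>Tails with positive coefficients\<close>

text \<open>
  Writing $R_k = z Q_{k+1}/Q_k$, the recurrence reads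
  $1/R_k = 1/z - \beta_k - \gamma_{k+1} R_{k+1}$. So if $R_{k+1}$ is in the upper half-plane, then
  $\mathrm{Im}(1/R_k) \le \mathrm{Im}(1/z)$, and $R_k$ is in the upper half-plane as well. The descent on
  \<open>k\<close> can be started, because $R_k \to z$.
\<close>

lemma half_plane_positive_tail:
  assumes pos: "\<And>j. j > N \<Longrightarrow> \<gamma> j > 0" and z: "Im z > 0" and "k \<ge> N"
  shows "tail_det k z \<noteq> 0"
    and "Im (tail_det k z / (z * tail_det (Suc k) z)) \<le> - Im z / (cmod z)\<^sup>2"
proof -
  define R where "R k = z * tail_det (Suc k) z / tail_det k z" for k
  have z0: "z \<noteq> 0" using z by auto
  have step: "tail_det k z \<noteq> 0 \<and> Im (R k) > 0 \<and> Im (tail_det k z / (z * tail_det (Suc k) z)) \<le> - Im z / (cmod z)\<^sup>2"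
    if k: "k \<ge> N" and nz: "tail_det (Suc k) z \<noteq> 0" and Im: "Im (R (Suc k)) > 0" for k
  proof -
    have "tail_det k z / (z * tail_det (Suc k) z) = 1 / z - of_real (\<beta> k) - of_real (\<gamma> (Suc k)) * R (Suc k)"
      unfolding tail_det_rec[of k z] R_def using z0 nz by (simp add: field_simps power2_eq_square)
    moreover have "Im (1 / z) = - Im z / (cmod z)\<^sup>2" by (simp add: Im_divide cmod_power2)
    moreover have "\<gamma> (Suc k) * Im (R (Suc k)) > 0" using pos[of "Suc k"] k Im by simp
    ultimately have *: "Im (tail_det k z / (z * tail_det (Suc k) z)) \<le> - Im z / (cmod z)\<^sup>2" by simp
    moreover have "- Im z / (cmod z)\<^sup>2 < 0" using z z0 by (simp add: divide_neg_pos)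
    ultimately have neg: "Im (tail_det k z / (z * tail_det (Suc k) z)) < 0" by linarith
    then have "tail_det k z \<noteq> 0" by auto
    have "R k = inverse (tail_det k z / (z * tail_det (Suc k) z))" by (simp add: R_def)
    moreover have "Im (inverse w) > 0" if "Im w < 0" for w
      using that by (simp add: divide_neg_pos sum_power2_gt_zero_iff)
    ultimately have "Im (R k) > 0" using neg by metis
    then show ?thesis using * \<open>tail_det k z \<noteq> 0\<close> by blast
  qed
  have "(\<lambda>k. R k) \<longlonglongrightarrow> z * 1 / 1"
    unfolding R_def by (intro tendsto_intros LIMSEQ_Suc tail_det_tendsto_1) auto
  then have "(\<lambda>k. Im (R k)) \<longlonglongrightarrow> Im z" using tendsto_Im by fastforce
  then have "\<forall>\<^sub>F k in sequentially. Im (R k) > 0" by (rule order_tendstoD) (rule z)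
  moreover have "\<forall>\<^sub>F k in sequentially. tail_det k z \<noteq> 0"
    by (rule tendsto_imp_eventually_ne[OF tail_det_tendsto_1]) auto
  ultimately have "\<forall>\<^sub>F k in sequentially. tail_det k z \<noteq> 0 \<and> Im (R k) > 0" by eventually_elim auto
  then obtain K0 where K0: "\<And>k. k \<ge> K0 \<Longrightarrow> tail_det k z \<noteq> 0 \<and> Im (R k) > 0"
    unfolding eventually_sequentially by blast
  define K where "K = max K0 (Suc k)"
  have "tail_det (Suc k) z \<noteq> 0 \<and> Im (R (Suc k)) > 0"
  proof (rule inc_induct[of "Suc k" K])
    show "Suc k \<le> K" "tail_det K z \<noteq> 0 \<and> Im (R K) > 0" using K0[of K] by (auto simp: K_def)
  next
    fix n assume "Suc k \<le> n" "tail_det (Suc n) z \<noteq> 0 \<and> Im (R (Suc n)) > 0"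
    then show "tail_det n z \<noteq> 0 \<and> Im (R n) > 0" using step[of n] \<open>k \<ge> N\<close> by auto
  qed
  then show "tail_det k z \<noteq> 0" "Im (tail_det k z / (z * tail_det (Suc k) z)) \<le> - Im z / (cmod z)\<^sup>2"
    using step[of k] \<open>k \<ge> N\<close> by auto
qed

text \<open>
  For a self-adjoint tail, $z\,Q_{k+1}/Q_k$ is the first diagonal entry of $(1/z - J_k)^{-1}$, so this is
  the bound of the resolvent by the inverse distance of $1/z$ to the real line.
\<close>

lemma resolvent_bound:
  assumes pos: "\<And>j. j > N \<Longrightarrow> \<gamma> j > 0" and "k \<ge> N" and "Im z \<noteq> 0"
  shows "tail_det k z \<noteq> 0" "cmod (z * tail_det (Suc k) z) * \<bar>Im z\<bar> \<le> (cmod z)\<^sup>2 * cmod (tail_det k z)"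
proof -
  have up: "tail_det k z \<noteq> 0 \<and> cmod (z * tail_det (Suc k) z) * \<bar>Im z\<bar> \<le> (cmod z)\<^sup>2 * cmod (tail_det k z)"
    if z: "Im z > 0" for z
  proof -
    have z0: "cmod z > 0" using z by auto
    have nz: "tail_det (Suc k) z \<noteq> 0" using half_plane_positive_tail(1)[of N z "Suc k"] assms z by auto
    have "Im z / (cmod z)\<^sup>2 \<le> cmod (tail_det k z / (z * tail_det (Suc k) z))"
      using half_plane_positive_tail(2)[of N z k] assms z abs_Im_le_cmod[of "tail_det k z / (z * tail_det (Suc k) z)"] by auto
    then have "cmod (z * tail_det (Suc k) z) * Im z \<le> (cmod z)\<^sup>2 * cmod (tail_det k z)"
      using z0 nz by (simp add: norm_divide norm_mult field_simps)
    then show ?thesis using half_plane_positive_tail(1)[of N z k] assms z by auto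
  qed
  have "tail_det k z \<noteq> 0 \<and> cmod (z * tail_det (Suc k) z) * \<bar>Im z\<bar> \<le> (cmod z)\<^sup>2 * cmod (tail_det k z)"
  proof (cases "Im z > 0")
    case False
    then have "Im (cnj z) > 0" using assms by auto
    from up[OF this] show ?thesis by (simp add: tail_det_cnj norm_mult)
  qed (rule up)
  then show "tail_det k z \<noteq> 0" "cmod (z * tail_det (Suc k) z) * \<bar>Im z\<bar> \<le> (cmod z)\<^sup>2 * cmod (tail_det k z)" by auto
qed

text \<open>
  A common zero of two neighbours is one of all later \<open>tail_det\<close>, which contradicts their limit \<open>1\<close>.
\<close>

lemma no_common_zero: "tail_det k z = 0 \<Longrightarrow> tail_det (Suc k) z \<noteq> 0"
proof
  assume 0: "tail_det k z = 0" "tail_det (Suc k) z = 0"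
  have *: "tail_det (k + n) z = 0 \<and> tail_det (Suc (k + n)) z = 0" for n
  proof (induction n)
    case (Suc n)
    have "of_real (\<gamma> (Suc (k + n))) * z\<^sup>2 * tail_det (Suc (Suc (k + n))) z = 0"
      using tail_det_rec[of "k + n" z] unfolding Suc.IH[THEN conjunct1] Suc.IH[THEN conjunct2] by auto
    moreover have "z \<noteq> 0" using \<open>tail_det k z = 0\<close> by auto
    ultimately show ?case using Suc.IH \<gamma>_nonzero[of "k + n"] by simp
  qed (simp add: 0)
  have "(\<lambda>n. tail_det (n + k) z) \<longlonglongrightarrow> 1" by (rule LIMSEQ_ignore_initial_segment[OF tail_det_tendsto_1])
  then show False using * by (simp add: add.commute LIMSEQ_const_iff)
qed

text \<open>
  Approach the real zero \<open>x\<close> vertically along $z = x + iy$: dividing the half-plane estimate for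
  $Q_k(z)/(z Q_{k+1}(z))$ by \<open>y\<close> leaves $Q_k'(x)/(x Q_{k+1}(x)) \le -1/x^2$ in the limit. In
  particular the zero is simple, and the sign of $Q_k'$ at it is opposite to that of $x Q_{k+1}$.
\<close>

lemma derivative_at_zero_positive_tail:
  assumes pos: "\<And>j. j > N \<Longrightarrow> \<gamma> j > 0" and "k \<ge> N" and 0: "tail_det k (of_real x) = 0"
  shows "Re (deriv (tail_det k) (of_real x) / (of_real x * tail_det (Suc k) (of_real x))) < 0"
proof -
  let ?x = "complex_of_real x" and ?g = "tail_det k" and ?h = "tail_det (Suc k)"
  have x0: "x \<noteq> 0" using 0 by auto
  have h0: "?h ?x \<noteq> 0" using no_common_zero[OF 0] .
  define w where "w y = ?x + of_real y * \<i>" for y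
  have w: "(w \<longlongrightarrow> ?x) (at_right 0)" unfolding w_def by (auto intro!: tendsto_eq_intros)
  have ev: "\<forall>\<^sub>F y in at_right (0::real). y > 0" by (simp add: eventually_at_right_less)
  have wat: "filterlim w (at ?x) (at_right 0)"
    using w by (rule filterlim_atI) (use ev in \<open>eventually_elim, auto simp: w_def\<close>)
  have "(?g has_field_derivative deriv ?g ?x) (at ?x)"
    using holomorphic_derivI[OF holomorphic_tail_det open_UNIV] by auto
  then have "((\<lambda>z. (?g z - ?g ?x) / (z - ?x)) \<longlongrightarrow> deriv ?g ?x) (at ?x)" by (simp add: DERIV_def has_field_derivative_iff)
  then have "((\<lambda>y. (?g (w y) - ?g ?x) / (w y - ?x)) \<longlongrightarrow> deriv ?g ?x) (at_right 0)"
    by (rule filterlim_compose[OF _ wat])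
  moreover have hc: "((\<lambda>y. ?h (w y)) \<longlongrightarrow> ?h ?x) (at_right 0)"
    by (rule continuous_on_tendsto_compose[OF holomorphic_on_imp_continuous_on[OF holomorphic_tail_det[where S=UNIV]] w]) auto
  ultimately have "((\<lambda>y. ((?g (w y) - ?g ?x) / (w y - ?x)) * (\<i> / (w y * ?h (w y)))) \<longlongrightarrow>
      deriv ?g ?x * (\<i> / (?x * ?h ?x))) (at_right 0)"
    using x0 h0 by (intro tendsto_intros w) auto
  then have lim: "((\<lambda>y. Im (((?g (w y) - ?g ?x) / (w y - ?x)) * (\<i> / (w y * ?h (w y))))) \<longlongrightarrow>
      Im (deriv ?g ?x * (\<i> / (?x * ?h ?x)))) (at_right 0)"
    by (rule tendsto_Im)
  have lim2: "((\<lambda>y. - 1 / (cmod (w y))\<^sup>2) \<longlongrightarrow> - 1 / (cmod ?x)\<^sup>2) (at_right 0)"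
    using x0 by (intro tendsto_intros w) auto
  have "Im (deriv ?g ?x * (\<i> / (?x * ?h ?x))) \<le> - 1 / (cmod ?x)\<^sup>2"
  proof (rule tendsto_le[OF _ lim2 lim])
    show "\<forall>\<^sub>F y in at_right 0. Im (((?g (w y) - ?g ?x) / (w y - ?x)) * (\<i> / (w y * ?h (w y)))) \<le> - 1 / (cmod (w y))\<^sup>2"
      using ev
    proof eventually_elim
      case (elim y)
      have "((?g (w y) - ?g ?x) / (w y - ?x)) * (\<i> / (w y * ?h (w y))) = of_real (1 / y) * (?g (w y) / (w y * ?h (w y)))"
        using 0 elim by (simp add: w_def field_simps)
      then have "Im (((?g (w y) - ?g ?x) / (w y - ?x)) * (\<i> / (w y * ?h (w y)))) = 1 / y * Im (?g (w y) / (w y * ?h (w y)))"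
        by (simp only: times_complex.sel Re_complex_of_real Im_complex_of_real mult_zero_left add_0_right)
      also have "\<dots> \<le> 1 / y * (- y / (cmod (w y))\<^sup>2)"
        using half_plane_positive_tail(2)[of N "w y" k] assms elim by (intro mult_left_mono) (auto simp: w_def)
      finally show ?case using elim by simp
    qed
  qed simp
  moreover have "- 1 / (cmod ?x)\<^sup>2 < 0" using x0 by simp
  moreover have "Im (deriv ?g ?x * (\<i> / (?x * ?h ?x))) = Re (deriv ?g ?x / (?x * ?h ?x))"
    by (metis Im_i_times mult.commute mult.right_neutral times_divide_eq_right)
  ultimately show ?thesis by linarith
qed

section \<open>Infinitely many zeros\<close>

lemma isCont_tail_det: "isCont (tail_det k) z"
  using holomorphic_on_imp_continuous_on[OF holomorphic_tail_det[of k UNIV]]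
  by (simp add: continuous_on_eq_continuous_at)

text \<open>
  Near \<open>0\<close> the value of \<open>tail_det\<close> is close to \<open>1\<close>, so \<open>p\<close> would vanish near \<open>0\<close>.
\<close>

lemma poly_mult_tail_det_eq_0:
  assumes "\<And>z. z \<noteq> 0 \<Longrightarrow> poly p z * tail_det k z = 0"
  shows "p = 0"
proof (rule ccontr)
  assume "p \<noteq> 0"
  then have "\<forall>\<^sub>F z in at 0. poly p z \<noteq> 0"
    using islimpt_finite[OF poly_roots_finite, of p 0] by (simp add: islimpt_iff_eventually)
  moreover have "\<forall>\<^sub>F z in at 0. tail_det k z \<noteq> 0"
    by (rule tendsto_imp_eventually_ne[OF isCont_tail_det[unfolded isCont_def]]) simp
  moreover have "\<forall>\<^sub>F z in at (0::complex). z \<noteq> 0" by (simp add: eventually_at_filter)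
  ultimately have "\<forall>\<^sub>F z in at (0::complex). False"
    by eventually_elim (use assms in auto)
  then show False by simp
qed

text \<open>
  Since \<open>tail_det k 0 = 1\<close>, a factor \<open>z\<close> of the product has to be one of the polynomial.
\<close>

lemma cancel_z:
  assumes "\<And>z. z \<noteq> 0 \<Longrightarrow> poly u z * tail_det k z = z * F z" and F: "isCont F 0"
  obtains v where "u = [:0, 1:] * v" and "\<And>z. z \<noteq> 0 \<Longrightarrow> poly v z * tail_det k z = F z"
proof -
  have lim_u: "((\<lambda>z. poly u z * tail_det k z) \<longlongrightarrow> poly u 0 * tail_det k 0) (at 0)"
    using isCont_tail_det[where k=k and z=0] by (intro tendsto_mult isContD poly_isCont)
  have lim_F: "((\<lambda>z. z * F z) \<longlongrightarrow> 0 * F 0) (at 0)"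
    using F by (intro tendsto_mult tendsto_ident_at isContD)
  have ev: "\<forall>\<^sub>F z in at 0. z * F z = poly u z * tail_det k z"
    using assms(1) by (simp add: eventually_at_filter)
  have "((\<lambda>z. poly u z * tail_det k z) \<longlongrightarrow> 0 * F 0) (at 0)"
    by (rule Lim_transform_eventually[OF lim_F ev])
  from LIM_unique[OF lim_u this] have "poly u 0 = 0" by simp
  then obtain v where v: "u = [:0, 1:] * v" using poly_eq_0_iff_dvd[of u 0] by (auto elim: dvdE)
  have "poly v z * tail_det k z = F z" if "z \<noteq> 0" for z
    using assms(1)[OF that] that unfolding v by simp
  then show ?thesis using v that by blast
qed

text \<open>
  Euclid's algorithm run on a continued fraction that does not end: by \<open>tail_det_rec\<close>, a
  representation of $Q_{k+1}/Q_k$ as a rational function yields one of $Q_{k+2}/Q_{k+1}$ with smaller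
  degrees. The factor $z^2$ that the recurrence provides is what lowers them.
\<close>

lemma tail_det_ratio_not_rational:
  assumes "p \<noteq> 0"
  shows "\<not> (\<forall>z. z \<noteq> 0 \<longrightarrow> poly p z * tail_det k z = poly s z * tail_det (Suc k) z)"
  using assms
proof (induction "max (degree p + 1) (degree s)" arbitrary: p s k rule: less_induct)
  case less
  show ?case
  proof
    assume rel: "\<forall>z. z \<noteq> 0 \<longrightarrow> poly p z * tail_det k z = poly s z * tail_det (Suc k) z"
    define u where "u = p * [:1, - of_real (\<beta> k):] - s"
    define q where "q = smult (of_real (\<gamma> (Suc k))) p"
    have q0: "q \<noteq> 0" using less.prems \<gamma>_nonzero by (simp add: q_def)
    have 1: "poly u z * tail_det (Suc k) z = z * (z * (poly q z * tail_det (Suc (Suc k)) z))" if "z \<noteq> 0" for z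
      using rel[rule_format, OF that] unfolding u_def q_def tail_det_rec[of k z]
      by (simp add: algebra_simps power2_eq_square)
    \<comment> \<open>the right-hand side of \<open>1\<close> contains \<open>z\<close> twice, so \<open>u\<close> is divisible by \<open>z\<^sup>2\<close>\<close>
    obtain u1 where u1: "u = [:0, 1:] * u1"
      and 2: "\<And>z. z \<noteq> 0 \<Longrightarrow> poly u1 z * tail_det (Suc k) z = z * (poly q z * tail_det (Suc (Suc k)) z)"
      by (rule cancel_z[of u "Suc k" "\<lambda>z. z * (poly q z * tail_det (Suc (Suc k)) z)", OF 1])
        (auto intro!: continuous_intros isCont_tail_det)
    obtain t where t: "u1 = [:0, 1:] * t"
      and 3: "\<And>z. z \<noteq> 0 \<Longrightarrow> poly t z * tail_det (Suc k) z = poly q z * tail_det (Suc (Suc k)) z"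
      by (rule cancel_z[of u1 "Suc k" "\<lambda>z. poly q z * tail_det (Suc (Suc k)) z", OF 2])
        (auto intro!: continuous_intros isCont_tail_det)
    have t0: "t \<noteq> 0" using 3 poly_mult_tail_det_eq_0[of q "Suc (Suc k)"] q0 by fastforce
    then have "degree u = degree t + 2" unfolding u1 t by (simp add: degree_mult_eq)
    moreover have "degree (p * [:1, - of_real (\<beta> k):]) \<le> degree p + 1"
      by (rule order_trans[OF degree_mult_le]) simp
    then have "degree u \<le> max (degree p + 1) (degree s)"
      unfolding u_def by (intro degree_diff_le_max[THEN order_trans] max.mono) auto
    moreover have "degree q \<le> degree p" unfolding q_def by (rule degree_smult_le)
    ultimately have "max (degree t + 1) (degree q) < max (degree p + 1) (degree s)" by auto
    from less.hyps[OF this t0, of "Suc k"] 3 show False by blast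
  qed
qed

lemma tail_det_zero_real:
  assumes "\<And>j. j > N \<Longrightarrow> \<gamma> j > 0" and "k \<ge> N" and "tail_det k z = 0"
  shows "z = of_real (Re z)"
  using resolvent_bound(1)[of N k z] assms by (auto simp: complex_eq_iff)

text \<open>
  Suppose the zeros form a finite set $Z$. They are simple, so $Q_k = e\prod_{\zeta \in Z}(z - \zeta)$ with
  $e$ entire and without zeros, and by the resolvent bound $z Q_{k+1}/e$ is a polynomial. Then
  $Q_{k+1}/Q_k$ is rational.
\<close>

lemma infinite_zeros_positive_tail:
  assumes pos: "\<And>j. j > N \<Longrightarrow> \<gamma> j > 0" and k: "k \<ge> N"
  shows "infinite {z. tail_det k z = 0}"
proof
  define Z where "Z = {z. tail_det k z = 0}"
  assume "finite {z. tail_det k z = 0}"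
  then have fin: "finite Z" by (simp add: Z_def)
  have "deriv (tail_det k) z \<noteq> 0" if "z \<in> Z" for z
    using derivative_at_zero_positive_tail[OF pos k, where x="Re z"] tail_det_zero_real[OF pos k, where z=z] that by (auto simp: Z_def)
  then have "\<exists>e. e holomorphic_on UNIV \<and> (\<forall>z. e z \<noteq> 0) \<and> (\<forall>z. tail_det k z = (\<Prod>\<zeta>\<in>Z. z - \<zeta>) * e z)"
    by (intro entire_factor_simple_zeros fin holomorphic_tail_det) (auto simp: Z_def)
  then obtain e where
    e: "e holomorphic_on UNIV" "\<And>z. e z \<noteq> 0" and g: "\<And>z. tail_det k z = (\<Prod>\<zeta>\<in>Z. z - \<zeta>) * e z"
    by blast
  define f where "f z = z * tail_det (Suc k) z / e z" for z
  have "\<exists>p. \<forall>z. f z = poly p z"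
  proof (rule entire_bounded_off_axis_imp_poly)
    show "f holomorphic_on UNIV"
      unfolding f_def[abs_def] using e by (intro holomorphic_intros holomorphic_tail_det) auto
    fix z :: complex assume z: "cmod z \<ge> 1"
    have bd: "cmod (f z) * \<bar>Im z\<bar> \<le> (cmod z)\<^sup>2 * (\<Prod>\<zeta>\<in>Z. cmod (z - \<zeta>))"
    proof (cases "Im z = 0")
      case True
      then show ?thesis by (simp add: prod_nonneg)
    next
      case False
      have "cmod (f z) * \<bar>Im z\<bar> = cmod (z * tail_det (Suc k) z) * \<bar>Im z\<bar> / cmod (e z)"
        by (simp add: f_def norm_divide)
      also have "\<dots> \<le> (cmod z)\<^sup>2 * cmod (tail_det k z) / cmod (e z)"
        using resolvent_bound(2)[OF pos k False] by (intro divide_right_mono) auto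
      also have "\<dots> = (cmod z)\<^sup>2 * (\<Prod>\<zeta>\<in>Z. cmod (z - \<zeta>))"
        using e(2)[of z] by (simp add: g norm_mult prod_norm)
      finally show ?thesis .
    qed
    have "(\<Prod>\<zeta>\<in>Z. cmod (z - \<zeta>)) \<le> (\<Prod>\<zeta>\<in>Z. cmod z * (1 + cmod \<zeta>))"
    proof (intro prod_mono conjI norm_ge_zero)
      fix \<zeta>
      have "cmod \<zeta> \<le> cmod z * cmod \<zeta>" using z by (simp add: mult_le_cancel_right1)
      then show "cmod (z - \<zeta>) \<le> cmod z * (1 + cmod \<zeta>)"
        using norm_triangle_ineq4[of z \<zeta>] by (simp add: algebra_simps)
    qed
    also have "\<dots> = cmod z ^ card Z * (\<Prod>\<zeta>\<in>Z. 1 + cmod \<zeta>)" by (simp add: prod.distrib)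
    finally have "(cmod z)\<^sup>2 * (\<Prod>\<zeta>\<in>Z. cmod (z - \<zeta>)) \<le> (cmod z)\<^sup>2 * (cmod z ^ card Z * (\<Prod>\<zeta>\<in>Z. 1 + cmod \<zeta>))"
      by (rule mult_left_mono) simp
    also have "\<dots> = (\<Prod>\<zeta>\<in>Z. 1 + cmod \<zeta>) * cmod z ^ (card Z + 2)"
      by (simp add: power_add power2_eq_square mult_ac)
    finally show "cmod (f z) * \<bar>Im z\<bar> \<le> (\<Prod>\<zeta>\<in>Z. 1 + cmod \<zeta>) * cmod z ^ (card Z + 2)"
      using bd by linarith
  qed
  then obtain p where p: "\<And>z. f z = poly p z" by auto
  define s where "s = [:0, 1:] * (\<Prod>\<zeta>\<in>Z. [:- \<zeta>, 1:])"
  have s0: "s \<noteq> 0" using fin by (auto simp: s_def)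
  have rel: "poly p z * tail_det k z = poly s z * tail_det (Suc k) z" for z
    using e(2)[of z] unfolding p[symmetric] f_def s_def g by (simp add: poly_prod)
  have "p \<noteq> 0"
    using rel poly_mult_tail_det_eq_0[of s "Suc k"] s0 by fastforce
  from tail_det_ratio_not_rational[OF this, of k s] rel show False by blast
qed

lemma of_real_Re_tail_det: "of_real (Re (tail_det k (of_real x))) = tail_det k (of_real x)"
  using tail_det_cnj[of k "of_real x"] by (simp add: complex_eq_iff)

lemma of_real_Re_trunc: "of_real (Re (trunc k n (of_real x))) = trunc k n (of_real x)"
  using trunc_cnj[of k n "of_real x"] by (simp add: complex_eq_iff)

lemma finite_zeros_tail_det: "finite {z \<in> cball 0 M. tail_det k z = 0}"
proof (cases "tail_det k constant_on UNIV")
  case True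
  then have "tail_det k z = 1" for z
    unfolding constant_on_def by (metis UNIV_I tail_det_0)
  then show ?thesis by simp
next
  case False
  then show ?thesis
    by (intro holomorphic_compact_finite_zeros[OF holomorphic_tail_det]) auto
qed

lemma DERIV_Re_tail_det:
  "((\<lambda>x. Re (tail_det k (of_real x))) has_real_derivative Re (deriv (tail_det k) (of_real x))) (at x)"
  unfolding has_real_derivative_iff_has_vector_derivative
  by (intro bounded_linear.has_vector_derivative[OF bounded_linear_Re] has_vector_derivative_real_field
      holomorphic_derivI[OF holomorphic_tail_det open_UNIV]) auto

text \<open>
  Suppose $Q_0$ had only finitely many zeros.
  Choose \<open>k\<close> beyond the indices with $\gamma_j \le 0$ and two zeros of $Q_k$ on the same side of a disc
  containing all zeros of $Q_0$ and of \<open>trunc 0 (k - 1)\<close>. On the interval between them the function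
  $\sigma = Q_0 \cdot \gamma_k \cdot x \cdot q_{k-1}$ has no zero. At a zero of $Q_k$ the expansion
  \<open>tail_det_split\<close> makes $\sigma$ a negative multiple of $x Q_{k+1}$, hence of the same sign as $Q_k'$.
  So $Q_k$ crosses zero always in the same direction, which it cannot do twice.
\<close>

lemma infinite_zeros_tail_det:
  assumes ev: "\<forall>\<^sub>F n in sequentially. \<gamma> n > 0"
  shows "infinite {z. tail_det 0 z = 0}"
proof
  assume fin0: "finite {z. tail_det 0 z = 0}"
  obtain n where n: "\<And>j. j \<ge> n \<Longrightarrow> \<gamma> j > 0"
    using ev unfolding eventually_sequentially by blast
  have pos: "\<gamma> j > 0" if "j > n" for j using n that by simp
  define k where "k = Suc n"
  obtain p where p: "\<And>z. trunc 0 n z = poly p z" using trunc_eq_poly by blast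
  have "p \<noteq> 0" using p[of 0] by auto
  then have fint: "finite {z. trunc 0 n z = 0}" unfolding p by (rule poly_roots_finite)
  define M where "M = Max (insert 0 (cmod ` ({z. tail_det 0 z = 0} \<union> {z. trunc 0 n z = 0})))"
  have M: "tail_det 0 z \<noteq> 0 \<and> trunc 0 n z \<noteq> 0" if "cmod z > M" for z
    using that fin0 fint Max_ge[of "insert 0 (cmod ` ({z. tail_det 0 z = 0} \<union> {z. trunc 0 n z = 0}))"]
    unfolding M_def by fastforce
  have M0: "M \<ge> 0" using fin0 fint unfolding M_def by (intro Max_ge) auto
  define X where "X = {x. tail_det k (of_real x) = 0}"
  have "{z. tail_det k z = 0} \<subseteq> complex_of_real ` X"
  proof
    fix z assume "z \<in> {z. tail_det k z = 0}"
    moreover from this have "z = of_real (Re z)"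
      using tail_det_zero_real[OF pos, where k=k and z=z] by (simp add: k_def)
    ultimately show "z \<in> complex_of_real ` X"
      unfolding X_def by (intro image_eqI[of _ _ "Re z"]) auto
  qed
  then have infX: "infinite X"
    using infinite_zeros_positive_tail[OF pos, of n k] finite_surj by (auto simp: k_def)
  have finX: "finite {x \<in> X. \<bar>x\<bar> \<le> L}" for L
    by (rule finite_subset[OF _ finite_vimageI[OF finite_zeros_tail_det[of L k] inj_of_real]]) (auto simp: X_def)
  obtain x1 x2 where x12: "x1 \<in> X" "x2 \<in> X" "x1 < x2" and large: "\<And>x. x \<in> {x1..x2} \<Longrightarrow> \<bar>x\<bar> > M"
    using two_large_points_same_side[OF infX finX] by metis
  define g g' where "g x = Re (tail_det k (of_real x))" and "g' x = Re (deriv (tail_det k) (of_real x))" for x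
  define \<sigma> where "\<sigma> x = Re (tail_det 0 (of_real x)) * Re (trunc 0 n (of_real x)) * (\<gamma> k * x)" for x
  have \<sigma>_nz: "\<sigma> x \<noteq> 0" if "x \<in> {x1..x2}" for x
    using M[of "of_real x"] large[OF that] M0 of_real_Re_tail_det[of 0 x] of_real_Re_trunc[of 0 n x] \<gamma>_nonzero[of n]
    by (auto simp: \<sigma>_def k_def)
  have \<sigma>_cont: "continuous_on S \<sigma>" for S
    unfolding \<sigma>_def
    by (intro continuous_intros continuous_on_compose2[OF holomorphic_on_imp_continuous_on[OF holomorphic_tail_det[of 0 UNIV]]]
        continuous_on_compose2[OF holomorphic_on_imp_continuous_on[OF holomorphic_trunc[of 0 n UNIV]]]) auto
  \<comment> \<open>the constant factor \<open>\<sigma> x1\<close> carries the sign of \<open>\<sigma>\<close> on the whole interval\<close>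
  have \<sigma>_sign: "\<sigma> x1 * \<sigma> x > 0" if x: "x \<in> {x1..x2}" for x
  proof (rule ccontr)
    assume "\<not> \<sigma> x1 * \<sigma> x > 0"
    then have "\<exists>y\<ge>x1. y \<le> x \<and> \<sigma> x1 * \<sigma> y = 0"
      using x by (intro IVT2' continuous_intros \<sigma>_cont) auto
    then show False using \<sigma>_nz x x12(3) by fastforce
  qed
  have \<sigma>_g': "g' x * \<sigma> x > 0" if x: "x \<in> {x1..x2}" and gx: "g x = 0" for x
  proof -
    define h where "h = x * Re (tail_det (Suc k) (of_real x))"
    have gz: "tail_det k (of_real x) = 0" using gx of_real_Re_tail_det[of k x] by (simp add: g_def)
    have h: "of_real h = of_real x * tail_det (Suc k) (of_real x)"
      by (simp add: h_def of_real_Re_tail_det)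
    have "Re (deriv (tail_det k) (of_real x) / of_real h) < 0"
      unfolding h by (rule derivative_at_zero_positive_tail[OF pos]) (use gz in \<open>auto simp: k_def\<close>)
    then have gh: "g' x / h < 0" by (simp add: g'_def)
    have "tail_det 0 (of_real x) =
        - (of_real (\<gamma> k) * of_real x * trunc 0 n (of_real x) * of_real h)"
      unfolding tail_det_split[of "of_real x" n] k_def[symmetric] gz h by (simp add: power2_eq_square)
    then have "complex_of_real (Re (tail_det 0 (of_real x))) = of_real (- (\<gamma> k * x * Re (trunc 0 n (of_real x)) * h))"
      unfolding of_real_Re_tail_det of_real_minus of_real_mult of_real_Re_trunc .
    then have "Re (tail_det 0 (of_real x)) = - (\<gamma> k * x * Re (trunc 0 n (of_real x)) * h)"
      by (simp only: of_real_eq_iff)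
    then have \<sigma>h: "\<sigma> x = - ((\<gamma> k * x * Re (trunc 0 n (of_real x)))\<^sup>2 * h)"
      by (simp add: \<sigma>_def power2_eq_square)
    with \<sigma>_nz[OF x] have "(\<gamma> k * x * Re (trunc 0 n (of_real x)))\<^sup>2 > 0" by auto
    moreover have "g' x * h < 0" using gh by (simp add: divide_less_0_iff mult_less_0_iff)
    ultimately have "(\<gamma> k * x * Re (trunc 0 n (of_real x)))\<^sup>2 * (g' x * h) < 0" by (rule mult_pos_neg)
    then show ?thesis unfolding \<sigma>h by (simp add: mult_ac)
  qed
  show False
  proof (rule no_two_increasing_zeros[of x1 x2 "\<lambda>x. \<sigma> x1 * g x" "\<lambda>x. \<sigma> x1 * g' x"])
    show "\<sigma> x1 * g x1 = 0" "\<sigma> x1 * g x2 = 0" using x12 by (auto simp: X_def g_def)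
    have "g x = 0 \<longleftrightarrow> x \<in> X" for x
      using of_real_Re_tail_det[of k x] by (auto simp: X_def g_def)
    then have "{x \<in> {x1..x2}. \<sigma> x1 * g x = 0} \<subseteq> {x \<in> X. \<bar>x\<bar> \<le> max \<bar>x1\<bar> \<bar>x2\<bar>}"
      using \<sigma>_nz[of x1] x12(3) by auto
    then show "finite {x \<in> {x1..x2}. \<sigma> x1 * g x = 0}" using finX finite_subset by blast
    show "((\<lambda>x. \<sigma> x1 * g x) has_real_derivative \<sigma> x1 * g' x) (at x)" for x
      unfolding g_def g'_def by (intro DERIV_cmult DERIV_Re_tail_det)
    fix x assume x: "x \<in> {x1..x2}" "\<sigma> x1 * g x = 0"
    then have "g x = 0" using \<sigma>_nz[of x1] x12(3) by auto
    from \<sigma>_g'[OF x(1) this] \<sigma>_sign[OF x(1)] show "\<sigma> x1 * g' x > 0"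
      by (auto simp: zero_less_mult_iff)
  qed (use x12 in auto)
qed

end

section \<open>A Schur test on square summable sequences\<close>

text \<open>
  Cauchy-Schwarz with each weight split into its square root twice.
\<close>

lemma schur_row:
  fixes K :: "nat \<Rightarrow> nat \<Rightarrow> complex"
  assumes K: "\<And>n m. cmod (K n m) \<le> w n m" and rows: "\<And>n M. (\<Sum>m<M. w n m) \<le> R"
  shows "(\<Sum>m<M. cmod (K n m * f m))\<^sup>2 \<le> R * (\<Sum>m<M. w n m * (cmod (f m))\<^sup>2)"
proof -
  have w0: "w n m \<ge> 0" for n m using K[of n m] norm_ge_zero order_trans by blast
  have "(\<Sum>m<M. cmod (K n m * f m))\<^sup>2 \<le> (\<Sum>m<M. sqrt (w n m) * (sqrt (w n m) * cmod (f m)))\<^sup>2"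
  proof (intro power_mono sum_mono sum_nonneg)
    fix m
    have "cmod (K n m * f m) \<le> w n m * cmod (f m)" using K by (simp add: norm_mult mult_right_mono)
    also have "w n m * cmod (f m) = sqrt (w n m) * (sqrt (w n m) * cmod (f m))"
      using w0[of n m] by (simp flip: mult.assoc)
    finally show "cmod (K n m * f m) \<le> sqrt (w n m) * (sqrt (w n m) * cmod (f m))" .
  qed simp
  also have "\<dots> \<le> (\<Sum>m<M. (sqrt (w n m))\<^sup>2) * (\<Sum>m<M. (sqrt (w n m) * cmod (f m))\<^sup>2)"
    by (rule Cauchy_Schwarz_ineq_sum)
  also have "\<dots> = (\<Sum>m<M. w n m) * (\<Sum>m<M. w n m * (cmod (f m))\<^sup>2)"
    using w0 by (simp add: power_mult_distrib)
  also have "\<dots> \<le> R * (\<Sum>m<M. w n m * (cmod (f m))\<^sup>2)"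
    using w0 by (intro mult_right_mono rows sum_nonneg) auto
  finally show ?thesis .
qed

text \<open>
  All double sums are kept finite, so that the order of summation can be exchanged freely: the
  sums over finite blocks are bounded uniformly, and the bound survives first the limit of the rows and then
  that of the sum over the rows.
\<close>

lemma schur_test:
  fixes K :: "nat \<Rightarrow> nat \<Rightarrow> complex"
  assumes K: "\<And>n m. cmod (K n m) \<le> w n m" and rows: "\<And>n M. (\<Sum>m<M. w n m) \<le> R"
    and cols: "\<And>m L. (\<Sum>n<L. w n m) \<le> R" and f: "f \<in> l2"
  shows "summable (\<lambda>m. K n m * f m)"
    and "mat_apply K f \<in> l2"
    and "l2_norm (mat_apply K f) \<le> R * l2_norm f"
proof -
  have w0: "w n m \<ge> 0" for n m using K[of n m] norm_ge_zero order_trans by blast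
  have R0: "R \<ge> 0" using rows[where n=0 and M=0] by simp
  have sf: "summable (\<lambda>m. (cmod (f m))\<^sup>2)" using f by (simp add: l2_def)
  define S where "S = (\<Sum>m. (cmod (f m))\<^sup>2)"
  have S: "(\<Sum>m<M. (cmod (f m))\<^sup>2) \<le> S" for M
    unfolding S_def by (rule sum_le_suminf[OF sf]) auto
  have block: "(\<Sum>n<L. (\<Sum>m<M. cmod (K n m * f m))\<^sup>2) \<le> R\<^sup>2 * S" for L M
  proof -
    have "(\<Sum>n<L. (\<Sum>m<M. cmod (K n m * f m))\<^sup>2) \<le> (\<Sum>n<L. R * (\<Sum>m<M. w n m * (cmod (f m))\<^sup>2))"
      by (intro sum_mono schur_row K rows)
    also have "\<dots> = R * (\<Sum>m<M. (\<Sum>n<L. w n m) * (cmod (f m))\<^sup>2)"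
      unfolding sum_distrib_left[symmetric] sum_distrib_right by (subst sum.swap) simp
    also have "\<dots> \<le> R * (\<Sum>m<M. R * (cmod (f m))\<^sup>2)"
      by (intro mult_left_mono sum_mono mult_right_mono cols R0) auto
    also have "\<dots> = R\<^sup>2 * (\<Sum>m<M. (cmod (f m))\<^sup>2)" by (simp add: sum_distrib_left power2_eq_square mult.assoc)
    also have "\<dots> \<le> R\<^sup>2 * S" by (intro mult_left_mono S) simp
    finally show ?thesis .
  qed
  have sK: "summable (\<lambda>m. cmod (K n m * f m))" for n
  proof (rule summableI_nonneg_bounded)
    fix M
    have "(\<Sum>m<M. cmod (K n m * f m))\<^sup>2 \<le> (\<Sum>i<Suc n. (\<Sum>m<M. cmod (K i m * f m))\<^sup>2)"
      by (rule member_le_sum) auto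
    also have "\<dots> \<le> R\<^sup>2 * S" by (rule block)
    finally show "(\<Sum>m<M. cmod (K n m * f m)) \<le> sqrt (R\<^sup>2 * S)" by (rule real_le_rsqrt)
  qed simp
  show sKf: "summable (\<lambda>m. K n m * f m)" for n by (rule summable_norm_cancel[OF sK])
  have part: "(\<Sum>n<L. (cmod (mat_apply K f n))\<^sup>2) \<le> R\<^sup>2 * S" for L
  proof (rule LIMSEQ_le_const2)
    show "(\<lambda>M. \<Sum>n<L. (cmod (\<Sum>m<M. K n m * f m))\<^sup>2) \<longlonglongrightarrow> (\<Sum>n<L. (cmod (mat_apply K f n))\<^sup>2)"
      unfolding mat_apply_def by (intro tendsto_intros summable_LIMSEQ sKf)
    have "(\<Sum>n<L. (cmod (\<Sum>m<M. K n m * f m))\<^sup>2) \<le> (\<Sum>n<L. (\<Sum>m<M. cmod (K n m * f m))\<^sup>2)" for M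
      by (intro sum_mono power_mono norm_sum) auto
    then show "\<exists>N. \<forall>M\<ge>N. (\<Sum>n<L. (cmod (\<Sum>m<M. K n m * f m))\<^sup>2) \<le> R\<^sup>2 * S"
      using block order_trans by blast
  qed
  have sm: "summable (\<lambda>n. (cmod (mat_apply K f n))\<^sup>2)"
    by (rule summableI_nonneg_bounded[OF _ part]) simp
  then show "mat_apply K f \<in> l2" by (simp add: l2_def)
  have "l2_norm (mat_apply K f) \<le> sqrt (R\<^sup>2 * S)"
    unfolding l2_norm_def by (intro real_sqrt_le_mono suminf_le_const[OF sm part])
  also have "\<dots> = R * l2_norm f" using R0 by (simp add: l2_norm_def S_def real_sqrt_mult)
  finally show "l2_norm (mat_apply K f) \<le> R * l2_norm f" .
qed

text \<open>
  This is $2^{-|n - m|}$: one of the two truncated differences is zero.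
\<close>

definition exp_weight :: "nat \<Rightarrow> nat \<Rightarrow> real" where
  "exp_weight n m = (1/2) ^ (n - m) * (1/2) ^ (m - n)"

lemma exp_weight_commute: "exp_weight n m = exp_weight m n" by (simp add: exp_weight_def)

text \<open>
  The bound proved by induction is sharper and distinguishes whether the diagonal has been passed.
\<close>

lemma exp_weight_sum_le: "(\<Sum>m<M. exp_weight n m) \<le> 3"
proof -
  have "(\<Sum>m<M. exp_weight n m) \<le> (if M \<le> n then (1/2) ^ (n - M) else 3 - (1/2) ^ (M - n - 1))"
  proof (induction M)
    case (Suc M)
    consider "Suc M \<le> n" | "M = n" | "M > n" by linarith
    then show ?case
    proof cases
      case 1
      then have "n - M = Suc (n - Suc M)" by simp
      then show ?thesis using Suc 1 by (simp add: exp_weight_def)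
    next
      case 2
      then show ?thesis using Suc by (simp add: exp_weight_def)
    next
      case 3
      then obtain k where k: "M = Suc (n + k)" using less_imp_Suc_add by blast
      then have "(\<Sum>m<M. exp_weight n m) \<le> 3 - (1/2) ^ k" "exp_weight n M = (1/2) ^ Suc k"
        using Suc by (simp_all add: exp_weight_def)
      then show ?thesis using k by simp
    qed
  qed simp
  also have "\<dots> \<le> 3" using power_le_one[of "1/2::real" "n - M"] by auto
  finally show ?thesis .
qed

lemma schur_test_exp_weight:
  fixes K :: "nat \<Rightarrow> nat \<Rightarrow> complex"
  assumes "\<And>n m. cmod (K n m) \<le> C * exp_weight n m" and "f \<in> l2"
  shows "summable (\<lambda>m. K n m * f m)" and "mat_apply K f \<in> l2"
    and "l2_norm (mat_apply K f) \<le> C * 3 * l2_norm f"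
proof -
  have "C \<ge> 0" using assms(1)[of 0 0] norm_ge_zero[of "K 0 0"] by (simp add: exp_weight_def del: norm_ge_zero)
  then have rows: "(\<Sum>m<M. C * exp_weight n m) \<le> C * 3" and cols: "(\<Sum>n<M. C * exp_weight n m) \<le> C * 3" for n m M
    unfolding sum_distrib_left[symmetric] using exp_weight_sum_le by (auto intro!: mult_left_mono simp: exp_weight_commute[of _ m])
  note schur_test[where w = "\<lambda>n m. C * exp_weight n m", OF assms(1) rows cols assms(2)]
  then show "summable (\<lambda>m. K n m * f m)" "mat_apply K f \<in> l2" "l2_norm (mat_apply K f) \<le> C * 3 * l2_norm f"
    by auto
qed

text \<open>
  All but finitely many factors are below $1/2$. The others are collected, scaled by \<open>2\<close> and bounded
  from below by \<open>1\<close>, in the constant.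
\<close>

lemma prod_decay:
  fixes c :: "nat \<Rightarrow> complex"
  assumes "c \<longlonglongrightarrow> 0"
  shows "\<exists>C. \<forall>i j. i \<le> j \<longrightarrow> (\<Prod>k\<in>{i..<j}. cmod (c k)) \<le> C * (1/2) ^ (j - i)"
proof -
  obtain N where N: "\<And>k. k \<ge> N \<Longrightarrow> cmod (c k) < 1/2"
    using LIMSEQ_D[OF assms, of "1/2"] by auto
  define d where "d k = max 1 (2 * cmod (c k))" for k
  have "(\<Prod>k\<in>{i..<j}. cmod (c k)) \<le> (\<Prod>k<N. d k) * (1/2) ^ (j - i)" for i j
  proof -
    have "(\<Prod>k\<in>{i..<j}. cmod (c k)) = (\<Prod>k\<in>{i..<j}. 2 * cmod (c k)) * (1/2) ^ (j - i)"
      by (simp add: prod.distrib power_divide)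
    also have "(\<Prod>k\<in>{i..<j}. 2 * cmod (c k)) \<le> (\<Prod>k\<in>{i..<j}. d k)"
      by (intro prod_mono) (auto simp: d_def)
    also have "(\<Prod>k\<in>{i..<j}. d k) = (\<Prod>k\<in>{i..<j} \<inter> {..<N}. d k)"
    proof (intro prod.mono_neutral_right ballI)
      fix k assume "k \<in> {i..<j} - {i..<j} \<inter> {..<N}"
      then have "k \<ge> N" by auto
      then show "d k = 1" using N[of k] by (simp add: d_def)
    qed auto
    also have "\<dots> \<le> (\<Prod>k<N. d k)"
      by (intro prod_mono2) (auto simp: d_def)
    finally show ?thesis by (simp add: mult_right_mono)
  qed
  then show ?thesis by blast
qed

lemma l2_lincomb:
  assumes "f \<in> l2" "g \<in> l2"
  shows "(\<lambda>n. f n - c * g n) \<in> l2"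
  unfolding l2_def mem_Collect_eq
proof (rule summable_comparison_test'[where N=0])
  show "summable (\<lambda>n. 2 * (cmod (f n))\<^sup>2 + 2 * (cmod c)\<^sup>2 * (cmod (g n))\<^sup>2)"
    using assms by (intro summable_add summable_mult) (auto simp: l2_def)
  fix n
  have "(cmod (f n - c * g n))\<^sup>2 \<le> (cmod (f n) + cmod (c * g n))\<^sup>2"
    by (intro power_mono norm_triangle_ineq4) simp
  also have "\<dots> \<le> 2 * (cmod (f n))\<^sup>2 + 2 * (cmod (c * g n))\<^sup>2"
    using sum_squares_bound[of "cmod (f n)" "cmod (c * g n)"] by (simp add: power2_sum)
  finally show "norm ((cmod (f n - c * g n))\<^sup>2) \<le> 2 * (cmod (f n))\<^sup>2 + 2 * (cmod c)\<^sup>2 * (cmod (g n))\<^sup>2"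
    by (simp add: norm_mult power_mult_distrib)
qed

lemma l2_tendsto_0:
  assumes "f \<in> l2"
  shows "f \<longlonglongrightarrow> 0"
proof -
  have "(\<lambda>n. (cmod (f n))\<^sup>2) \<longlonglongrightarrow> 0" using assms by (intro summable_LIMSEQ_zero) (simp add: l2_def)
  then have "(\<lambda>n. sqrt ((cmod (f n))\<^sup>2)) \<longlonglongrightarrow> sqrt 0" by (intro tendsto_intros)
  then show ?thesis by (simp add: tendsto_norm_zero_iff)
qed

section \<open>Zeros and the spectrum\<close>

text \<open>
  \<open>\<a> n\<close> couples \<open>n - 1\<close> and \<open>n\<close> symmetrically. It is imaginary where \<open>\<gamma> n\<close> is negative.
\<close>

locale jacobi_matrix = jacobi_coeffs +
  fixes \<a> :: "nat \<Rightarrow> complex"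
  assumes \<a>_sq: "\<And>n. (\<a> n)\<^sup>2 = of_real (\<gamma> n)"
begin

definition jac :: "nat \<Rightarrow> nat \<Rightarrow> complex" where
  "jac i j =
     (if i = j then of_real (\<beta> i)
      else if j = Suc i then \<a> j
      else if i = Suc j then \<a> i
      else 0)"

lemma \<a>_nonzero: "\<a> (Suc n) \<noteq> 0"
  using \<a>_sq[of "Suc n"] \<gamma>_nonzero[of n] by auto

lemma \<a>_tendsto_0: "\<a> \<longlonglongrightarrow> 0"
proof -
  have "(\<lambda>n. sqrt \<bar>\<gamma> n\<bar>) \<longlonglongrightarrow> sqrt 0"
    by (intro tendsto_intros summable_LIMSEQ_zero[OF summable_\<gamma>])
  moreover have "sqrt \<bar>\<gamma> n\<bar> = cmod (\<a> n)" for n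
    using arg_cong[OF \<a>_sq[of n], of cmod] by (simp add: norm_power real_sqrt_unique)
  ultimately show ?thesis by (simp add: tendsto_norm_zero_iff)
qed

lemma mat_apply_jac_0: "mat_apply jac u 0 = of_real (\<beta> 0) * u 0 + \<a> 1 * u 1"
proof -
  have "mat_apply jac u 0 = (\<Sum>j\<in>{0, 1}. jac 0 j * u j)"
    unfolding mat_apply_def by (rule suminf_finite) (auto simp: jac_def)
  then show ?thesis by (simp add: jac_def)
qed

lemma mat_apply_jac_Suc:
  "mat_apply jac u (Suc n) =
     \<a> (Suc n) * u n + of_real (\<beta> (Suc n)) * u (Suc n) + \<a> (Suc (Suc n)) * u (Suc (Suc n))"
proof -
  have "mat_apply jac u (Suc n) = (\<Sum>j\<in>{n, Suc n, Suc (Suc n)}. jac (Suc n) j * u j)"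
    unfolding mat_apply_def by (rule suminf_finite) (auto simp: jac_def)
  then show ?thesis by (simp add: jac_def)
qed

lemma jac_exp_weight_bound: "\<exists>C. \<forall>i j. cmod (jac i j) \<le> C * exp_weight i j"
proof -
  have "(\<lambda>n. \<bar>\<beta> n\<bar>) \<longlonglongrightarrow> 0" by (rule summable_LIMSEQ_zero[OF summable_\<beta>])
  then have "\<beta> \<longlonglongrightarrow> 0" by (simp add: tendsto_rabs_zero_iff)
  then have "Bseq \<beta>" by (intro convergent_imp_Bseq convergentI)
  then obtain B where B: "\<And>n. \<bar>\<beta> n\<bar> \<le> B" unfolding Bseq_def real_norm_def by blast
  have "Bseq \<a>" using \<a>_tendsto_0 by (intro convergent_imp_Bseq convergentI)
  then obtain A where A: "\<And>n. cmod (\<a> n) \<le> A" unfolding Bseq_def by blast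
  have "A \<ge> 0" "B \<ge> 0" using A[of 0] B[of 0] norm_ge_zero[of "\<a> 0"] abs_ge_zero[of "\<beta> 0"] by linarith+
  have *: "cmod (jac i j) \<le> (2 * A + B) * exp_weight i j" for i j
  proof -
    consider "i = j" | "j = Suc i" | "i = Suc j" | "i \<noteq> j" "j \<noteq> Suc i" "i \<noteq> Suc j" by blast
    then show ?thesis
    proof cases
      case 1
      then show ?thesis using B[of i] \<open>A \<ge> 0\<close> by (simp add: jac_def exp_weight_def add_increasing)
    next
      case 2
      then show ?thesis using A[of j] \<open>B \<ge> 0\<close> by (simp add: jac_def exp_weight_def)
    next
      case 3
      then show ?thesis using A[of i] \<open>B \<ge> 0\<close> by (simp add: jac_def exp_weight_def)
    next
      case 4
      then show ?thesis using \<open>A \<ge> 0\<close> \<open>B \<ge> 0\<close> by (simp add: jac_def exp_weight_def)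
    qed
  qed
  show ?thesis using * by blast
qed

definition offdiag_prod :: "complex \<Rightarrow> nat \<Rightarrow> complex" where
  "offdiag_prod z n = (\<Prod>k<n. z * \<a> (Suc k))"

text \<open>
  The solution of the three-term recurrence that is square summable at infinity. It solves the first
  row as well only if \<open>tail_det 0 z = 0\<close>.
\<close>

definition decaying :: "complex \<Rightarrow> nat \<Rightarrow> complex" where
  "decaying z n = offdiag_prod z n * tail_det (Suc n) z"

text \<open>
  The solution that satisfies the first row, with initial value \<open>1\<close>; it is the orthonormal
  polynomial of degree \<open>n\<close> at the point \<open>1 / z\<close>, up to the choice of square roots.
\<close>

definition regular :: "complex \<Rightarrow> nat \<Rightarrow> complex" where
  "regular z n = trunc 0 n z / offdiag_prod z n"

lemma za_prod_decay:
  "\<exists>C. \<forall>i j. i \<le> j \<longrightarrow> (\<Prod>k\<in>{i..<j}. cmod (z * \<a> (Suc k))) \<le> C * (1/2) ^ (j - i)"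
proof -
  have "(\<lambda>n. z * \<a> (Suc n)) \<longlonglongrightarrow> z * 0" by (intro tendsto_intros LIMSEQ_Suc \<a>_tendsto_0)
  then have "(\<lambda>n. z * \<a> (Suc n)) \<longlonglongrightarrow> 0" by simp
  from prod_decay[OF this] show ?thesis .
qed

lemma offdiag_prod_Suc: "offdiag_prod z (Suc n) = offdiag_prod z n * (z * \<a> (Suc n))"
  by (simp add: offdiag_prod_def)

lemma offdiag_prod_nonzero: "z \<noteq> 0 \<Longrightarrow> offdiag_prod z n \<noteq> 0"
  using \<a>_nonzero by (auto simp: offdiag_prod_def)

lemma za_sq: "(z * \<a> n) * (z * \<a> n) = of_real (\<gamma> n) * z\<^sup>2"
  using \<a>_sq[of n] by (simp add: power2_eq_square mult_ac)

text \<open>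
  The right-hand side is what the term with index \<open>n - 1\<close> contributes; for \<open>n = 0\<close> there is no such
  term, and \<open>tail_det 0 z\<close> remains as the defect in the first row.
\<close>

lemma decaying_rec:
  "(1 - of_real (\<beta> n) * z) * decaying z n - z * \<a> (Suc n) * decaying z (Suc n) = offdiag_prod z n * tail_det n z"
proof -
  have "z * \<a> (Suc n) * decaying z (Suc n) =
      offdiag_prod z n * ((z * \<a> (Suc n)) * (z * \<a> (Suc n))) * tail_det (Suc (Suc n)) z"
    unfolding decaying_def offdiag_prod_Suc by (simp only: mult_ac)
  then have *: "z * \<a> (Suc n) * decaying z (Suc n) = offdiag_prod z n * (of_real (\<gamma> (Suc n)) * z\<^sup>2) * tail_det (Suc (Suc n)) z"
    unfolding za_sq .
  show ?thesis
    unfolding * unfolding decaying_def tail_det_rec[of n z] by (simp add: algebra_simps)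
qed

lemma decaying_rec_Suc:
  "(1 - of_real (\<beta> (Suc n)) * z) * decaying z (Suc n) - z * \<a> (Suc (Suc n)) * decaying z (Suc (Suc n))
     - z * \<a> (Suc n) * decaying z n = 0"
  unfolding decaying_rec by (simp add: decaying_def offdiag_prod_Suc)

lemma regular_rec_0:
  assumes "z \<noteq> 0"
  shows "(1 - of_real (\<beta> 0) * z) * regular z 0 - z * \<a> (Suc 0) * regular z (Suc 0) = 0"
  using assms \<a>_nonzero[of 0] by (simp add: regular_def offdiag_prod_def)

lemma regular_rec_Suc:
  assumes z: "z \<noteq> 0"
  shows "(1 - of_real (\<beta> (Suc n)) * z) * regular z (Suc n) - z * \<a> (Suc (Suc n)) * regular z (Suc (Suc n))
     - z * \<a> (Suc n) * regular z n = 0"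
proof -
  have nz: "z * \<a> (Suc k) \<noteq> 0" for k using z \<a>_nonzero by simp
  have 1: "z * \<a> (Suc (Suc n)) * regular z (Suc (Suc n)) = trunc 0 (Suc (Suc n)) z / offdiag_prod z (Suc n)"
    unfolding regular_def offdiag_prod_Suc[of z "Suc n"] using nz[of "Suc n"] by simp
  have 2: "z * \<a> (Suc n) * regular z n = (z * \<a> (Suc n)) * (z * \<a> (Suc n)) * trunc 0 n z / offdiag_prod z (Suc n)"
    unfolding regular_def offdiag_prod_Suc[of z n] using nz[of n] by simp
  show ?thesis unfolding 1 2 za_sq unfolding regular_def trunc.simps(3)
    by (simp add: diff_divide_distrib)
qed

lemma wronskian_Suc:
  assumes z: "z \<noteq> 0"
  shows "z * \<a> (Suc n) * (regular z (Suc n) * decaying z n - regular z n * decaying z (Suc n)) = tail_det 0 z"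
proof -
  define c where "c = z * \<a> (Suc n)"
  have nz: "c \<noteq> 0" "offdiag_prod z n \<noteq> 0" using z \<a>_nonzero offdiag_prod_nonzero[OF z] by (auto simp: c_def)
  have csq: "c * c = of_real (\<gamma> (Suc n)) * z\<^sup>2" unfolding c_def by (rule za_sq)
  have "c * (regular z (Suc n) * decaying z n) = trunc 0 (Suc n) z * tail_det (Suc n) z"
    unfolding regular_def decaying_def offdiag_prod_Suc c_def[symmetric] using nz by simp
  moreover have "c * (regular z n * decaying z (Suc n)) = (c * c) * trunc 0 n z * tail_det (Suc (Suc n)) z"
    unfolding regular_def decaying_def offdiag_prod_Suc c_def[symmetric] using nz by simp
  ultimately show ?thesis
    unfolding csq tail_det_split[of z n] c_def[symmetric] right_diff_distrib by (simp only:)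
qed

lemma decaying_l2: "decaying z \<in> l2"
proof -
  obtain C where C: "\<And>i j. i \<le> j \<Longrightarrow> (\<Prod>k\<in>{i..<j}. cmod (z * \<a> (Suc k))) \<le> C * (1/2) ^ (j - i)"
    using za_prod_decay[of z] by blast
  show ?thesis
    unfolding l2_def mem_Collect_eq
  proof (rule summable_comparison_test'[where N=0])
    show "summable (\<lambda>n. (C * trunc_bound (cmod z))\<^sup>2 * (1/4) ^ n)" by (intro summable_mult summable_geometric) simp
    fix n
    have "cmod (decaying z n) \<le> (C * (1/2) ^ n) * trunc_bound (cmod z)"
      unfolding decaying_def norm_mult
    proof (rule mult_mono)
      show "cmod (offdiag_prod z n) \<le> C * (1/2) ^ n"
        using C[of 0 n] by (simp add: offdiag_prod_def prod_norm lessThan_atLeast0)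
      then show "0 \<le> C * (1/2) ^ n" using norm_ge_zero order_trans by blast
    qed (simp_all add: tail_det_bounded)
    then have "(cmod (decaying z n))\<^sup>2 \<le> (C * (1/2) ^ n * trunc_bound (cmod z))\<^sup>2" by (intro power_mono) auto
    moreover have quarter: "((1/2) ^ n)\<^sup>2 = (1/4::real) ^ n"
      by (simp add: power2_eq_square flip: power_mult_distrib)
    ultimately show "norm ((cmod (decaying z n))\<^sup>2) \<le> (C * trunc_bound (cmod z))\<^sup>2 * (1/4) ^ n"
      by (simp only: power_mult_distrib quarter real_norm_def abs_power2 mult_ac)
  qed
qed

text \<open>
  The kernel of $(J - 1/z)^{-1} = -z\,(1 - zJ)^{-1}$.
\<close>

definition green :: "complex \<Rightarrow> nat \<Rightarrow> nat \<Rightarrow> complex" where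
  "green z n m = - z * (regular z (min n m) * decaying z (max n m)) / tail_det 0 z"

text \<open>
  The numerator of \<open>decaying\<close> and the denominator of \<open>regular\<close> combine to the product of all $z a_k$
  with \<open>min n m < k \<le> max n m\<close>, which decays by \<open>prod_decay\<close>.
\<close>

lemma green_exp_weight_bound:
  assumes z: "z \<noteq> 0"
  shows "\<exists>C. \<forall>n m. cmod (green z n m) \<le> C * exp_weight n m"
proof -
  obtain C where C: "\<And>i j. i \<le> j \<Longrightarrow> (\<Prod>k\<in>{i..<j}. cmod (z * \<a> (Suc k))) \<le> C * (1/2) ^ (j - i)"
    using za_prod_decay[of z] by blast
  have b0: "trunc_bound (cmod z) \<ge> 0" by (simp add: trunc_bound_def)
  have C0: "C \<ge> 0" using C[of 0 0] by simp
  have up: "cmod (regular z i * decaying z j) \<le> (trunc_bound (cmod z))\<^sup>2 * C * exp_weight i j" if "i \<le> j" for i j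
  proof -
    have "offdiag_prod z j = offdiag_prod z i * (\<Prod>k\<in>{i..<j}. z * \<a> (Suc k))"
      unfolding offdiag_prod_def lessThan_atLeast0 using that by (simp add: prod.atLeastLessThan_concat)
    then have "regular z i * decaying z j = trunc 0 i z * tail_det (Suc j) z * (\<Prod>k\<in>{i..<j}. z * \<a> (Suc k))"
      unfolding regular_def decaying_def using offdiag_prod_nonzero[OF z, of i] by simp
    also have "cmod \<dots> = cmod (trunc 0 i z) * cmod (tail_det (Suc j) z) * (\<Prod>k\<in>{i..<j}. cmod (z * \<a> (Suc k)))"
      unfolding prod_norm by (simp add: norm_mult)
    also have "\<dots> \<le> trunc_bound (cmod z) * trunc_bound (cmod z) * (C * (1/2) ^ (j - i))"
      using C[OF that] b0 by (intro mult_mono trunc_bounded tail_det_bounded prod_nonneg) auto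
    also have "\<dots> = (trunc_bound (cmod z))\<^sup>2 * C * exp_weight i j" using that by (simp add: exp_weight_def power2_eq_square)
    finally show ?thesis .
  qed
  have "cmod (green z n m) \<le> cmod z * ((trunc_bound (cmod z))\<^sup>2 * C) / cmod (tail_det 0 z) * exp_weight n m" for n m
  proof -
    have "exp_weight (min n m) (max n m) = exp_weight n m" by (simp add: min_def max_def exp_weight_commute)
    then have "cmod (regular z (min n m) * decaying z (max n m)) \<le> (trunc_bound (cmod z))\<^sup>2 * C * exp_weight n m"
      using up[of "min n m" "max n m"] by simp
    then have "cmod z * cmod (regular z (min n m) * decaying z (max n m)) / cmod (tail_det 0 z)
        \<le> cmod z * ((trunc_bound (cmod z))\<^sup>2 * C * exp_weight n m) / cmod (tail_det 0 z)"
      by (intro divide_right_mono mult_left_mono) auto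
    then show ?thesis by (simp add: green_def norm_mult norm_divide)
  qed
  then show ?thesis by blast
qed

text \<open>
  Row \<open>0\<close> of the matrix equation $(1 - zJ)\,G = -z$ for the Green kernel $G$.
\<close>

lemma green_column_0:
  assumes z: "z \<noteq> 0" and nz: "tail_det 0 z \<noteq> 0"
  shows "(1 - of_real (\<beta> 0) * z) * green z 0 m - z * \<a> 1 * green z 1 m = (if m = 0 then - z else 0)"
proof (cases m)
  case 0
  have "(1 - of_real (\<beta> 0) * z) * green z 0 0 - z * \<a> 1 * green z 1 0
     = - z / tail_det 0 z * (regular z 0 * ((1 - of_real (\<beta> 0) * z) * decaying z 0 - z * \<a> (Suc 0) * decaying z (Suc 0)))"
    by (simp add: green_def divide_simps algebra_simps)
  also have "\<dots> = - z"
    unfolding decaying_rec using nz by (simp add: regular_def offdiag_prod_def)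
  finally show ?thesis using 0 by simp
next
  case (Suc k)
  have "(1 - of_real (\<beta> 0) * z) * green z 0 m - z * \<a> 1 * green z 1 m
     = - z / tail_det 0 z * (decaying z m * ((1 - of_real (\<beta> 0) * z) * regular z 0 - z * \<a> (Suc 0) * regular z (Suc 0)))"
    using nz by (simp add: green_def Suc divide_simps algebra_simps)
  then show ?thesis unfolding regular_rec_0[OF z] using Suc by simp
qed

text \<open>
  Above and below the diagonal only one of the two solutions varies with the row, and the recurrence
  makes the entry vanish. On the diagonal the change from one solution to the other leaves their
  Wronskian, which cancels the denominator of the kernel.
\<close>

lemma green_column_Suc:
  assumes z: "z \<noteq> 0" and nz: "tail_det 0 z \<noteq> 0"
  shows "(1 - of_real (\<beta> (Suc n)) * z) * green z (Suc n) m - z * \<a> (Suc (Suc n)) * green z (Suc (Suc n)) m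
    - z * \<a> (Suc n) * green z n m = (if m = Suc n then - z else 0)" (is "?L = _")
proof -
  consider "m \<le> n" | "m = Suc n" | "m > Suc n" by linarith
  then show ?thesis
  proof cases
    case 1
    then have "?L = - z / tail_det 0 z * (regular z m * ((1 - of_real (\<beta> (Suc n)) * z) * decaying z (Suc n)
       - z * \<a> (Suc (Suc n)) * decaying z (Suc (Suc n)) - z * \<a> (Suc n) * decaying z n))"
      using nz by (simp add: green_def divide_simps algebra_simps)
    then show ?thesis unfolding decaying_rec_Suc using 1 by simp
  next
    case 2
    have "?L = - z / tail_det 0 z * (regular z (Suc n) * ((1 - of_real (\<beta> (Suc n)) * z) * decaying z (Suc n)
       - z * \<a> (Suc (Suc n)) * decaying z (Suc (Suc n)) - z * \<a> (Suc n) * decaying z n)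
       + z * \<a> (Suc n) * (regular z (Suc n) * decaying z n - regular z n * decaying z (Suc n)))"
      using nz by (simp add: green_def 2 divide_simps algebra_simps)
    then show ?thesis unfolding decaying_rec_Suc wronskian_Suc[OF z] using 2 nz by simp
  next
    case 3
    then have "?L = - z / tail_det 0 z * (decaying z m * ((1 - of_real (\<beta> (Suc n)) * z) * regular z (Suc n)
       - z * \<a> (Suc (Suc n)) * regular z (Suc (Suc n)) - z * \<a> (Suc n) * regular z n))"
      using nz by (simp add: green_def divide_simps algebra_simps)
    then show ?thesis unfolding regular_rec_Suc[OF z] using 3 by simp
  qed
qed

lemma green_right_inverse:
  assumes z: "z \<noteq> 0" and nz: "tail_det 0 z \<noteq> 0" and f: "f \<in> l2"
  shows "l2_shifted jac (1 / z) (mat_apply (green z) f) = f"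
proof
  fix i
  obtain C where C: "\<And>n m. cmod (green z n m) \<le> C * exp_weight n m" using green_exp_weight_bound[OF z] by blast
  let ?v = "mat_apply (green z) f"
  have v: "(\<lambda>m. green z n m * f m) sums ?v n" for n
    unfolding mat_apply_def by (rule summable_sums) (rule schur_test_exp_weight(1)[OF C f])
  have delta: "(\<lambda>m. (if m = k then - z else 0) * f m) sums (- z * f k)" for k
    using sums_single[of k "\<lambda>m. - z * f m"] by (simp add: if_distrib[of "\<lambda>t. t * _"] cong: if_cong)
  have *: "?v i - z * mat_apply jac ?v i = - z * f i"
  proof (cases i)
    case 0
    have "(\<lambda>m. (1 - of_real (\<beta> 0) * z) * (green z 0 m * f m) - z * \<a> 1 * (green z 1 m * f m)) sums
        ((1 - of_real (\<beta> 0) * z) * ?v 0 - z * \<a> 1 * ?v 1)"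
      by (intro sums_diff sums_mult v)
    moreover have "(1 - of_real (\<beta> 0) * z) * (green z 0 m * f m) - z * \<a> 1 * (green z 1 m * f m)
        = (if m = 0 then - z else 0) * f m" for m
      unfolding green_column_0[OF z nz, symmetric] by (simp add: algebra_simps)
    ultimately have "(1 - of_real (\<beta> 0) * z) * ?v 0 - z * \<a> 1 * ?v 1 = - z * f 0"
      using delta[of 0] sums_unique2 by simp
    then show ?thesis unfolding 0 mat_apply_jac_0 by (simp add: algebra_simps)
  next
    case (Suc n)
    have "(\<lambda>m. (1 - of_real (\<beta> (Suc n)) * z) * (green z (Suc n) m * f m)
          - z * \<a> (Suc (Suc n)) * (green z (Suc (Suc n)) m * f m) - z * \<a> (Suc n) * (green z n m * f m)) sums
        ((1 - of_real (\<beta> (Suc n)) * z) * ?v (Suc n) - z * \<a> (Suc (Suc n)) * ?v (Suc (Suc n)) - z * \<a> (Suc n) * ?v n)"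
      by (intro sums_diff sums_mult v)
    moreover have "(1 - of_real (\<beta> (Suc n)) * z) * (green z (Suc n) m * f m)
          - z * \<a> (Suc (Suc n)) * (green z (Suc (Suc n)) m * f m) - z * \<a> (Suc n) * (green z n m * f m)
        = (if m = Suc n then - z else 0) * f m" for m
      unfolding green_column_Suc[OF z nz, symmetric] by (simp add: algebra_simps)
    ultimately have "(1 - of_real (\<beta> (Suc n)) * z) * ?v (Suc n) - z * \<a> (Suc (Suc n)) * ?v (Suc (Suc n)) - z * \<a> (Suc n) * ?v n = - z * f (Suc n)"
      using delta[of "Suc n"] sums_unique2 by simp
    then show ?thesis unfolding Suc mat_apply_jac_Suc by (simp add: algebra_simps)
  qed
  have "l2_shifted jac (1 / z) ?v i = - (?v i - z * mat_apply jac ?v i) / z"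
    unfolding l2_shifted_def using z by (simp add: divide_simps)
  then show "l2_shifted jac (1 / z) ?v i = f i" unfolding * using z by simp
qed

lemma l2_shifted_jac_l2:
  assumes "u \<in> l2"
  shows "l2_shifted jac x u \<in> l2"
proof -
  obtain C where C: "\<And>i j. cmod (jac i j) \<le> C * exp_weight i j" using jac_exp_weight_bound by blast
  show ?thesis
    unfolding l2_shifted_def by (intro l2_lincomb schur_test_exp_weight(2)[OF C] assms)
qed

text \<open>
  A solution is determined by its first entry and hence a multiple of \<open>regular\<close>. Multiplied with
  \<open>offdiag_prod\<close>, which tends to zero, a null sequence \<open>d\<close> tends to zero; but this product is
  \<open>d 0 * trunc 0 n z\<close>, with the limit \<open>d 0 * tail_det 0 z\<close>.
\<close>

lemma jac_eigenvector_eq_0: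
  assumes z: "z \<noteq> 0" and nz: "tail_det 0 z \<noteq> 0" and d: "d \<in> l2"
    and eig: "\<And>i. mat_apply jac d i = 1 / z * d i"
  shows "d i = 0"
proof -
  have zd: "z * mat_apply jac d i = d i" for i using eig[of i] z by simp
  have reg: "d n = d 0 * regular z n \<and> d (Suc n) = d 0 * regular z (Suc n)" for n
  proof (induction n)
    case 0
    have r0: "regular z 0 = 1" by (simp add: regular_def offdiag_prod_def)
    have "z * \<a> 1 * d 1 = (1 - of_real (\<beta> 0) * z) * d 0"
      using zd[of 0] unfolding mat_apply_jac_0 by (simp add: algebra_simps)
    also have "1 - of_real (\<beta> 0) * z = z * \<a> 1 * regular z 1"
      using regular_rec_0[OF z] by (simp add: r0)
    also have "\<dots> * d 0 = z * \<a> 1 * (d 0 * regular z 1)" by simp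
    finally show ?case using z \<a>_nonzero[of 0] r0 by simp
  next
    case (Suc n)
    have "z * \<a> (Suc (Suc n)) * d (Suc (Suc n)) = (1 - of_real (\<beta> (Suc n)) * z) * d (Suc n) - z * \<a> (Suc n) * d n"
      using zd[of "Suc n"] unfolding mat_apply_jac_Suc by (simp add: algebra_simps)
    also have "\<dots> = d 0 * ((1 - of_real (\<beta> (Suc n)) * z) * regular z (Suc n) - z * \<a> (Suc n) * regular z n)"
      using Suc by (simp add: algebra_simps)
    also have "(1 - of_real (\<beta> (Suc n)) * z) * regular z (Suc n) - z * \<a> (Suc n) * regular z n = z * \<a> (Suc (Suc n)) * regular z (Suc (Suc n))"
      using regular_rec_Suc[OF z, of n] by (simp add: algebra_simps)
    finally show ?case using z \<a>_nonzero[of "Suc n"] Suc by simp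
  qed
  obtain C where C: "\<And>i j. i \<le> j \<Longrightarrow> (\<Prod>k\<in>{i..<j}. cmod (z * \<a> (Suc k))) \<le> C * (1/2) ^ (j - i)"
    using za_prod_decay[of z] by blast
  have "offdiag_prod z \<longlonglongrightarrow> 0"
  proof (rule Lim_null_comparison[OF always_eventually])
    show "\<forall>n. cmod (offdiag_prod z n) \<le> C * (1/2) ^ n"
      using C[of 0] by (simp add: offdiag_prod_def prod_norm lessThan_atLeast0)
    show "(\<lambda>n. C * (1/2) ^ n) \<longlonglongrightarrow> 0" by real_asymp
  qed
  then have "(\<lambda>n. d n * offdiag_prod z n) \<longlonglongrightarrow> 0 * 0" by (rule tendsto_mult[OF l2_tendsto_0[OF d]])
  moreover have "d n * offdiag_prod z n = d 0 * trunc 0 n z" for n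
    using reg[of n] offdiag_prod_nonzero[OF z, of n] by (simp add: regular_def)
  ultimately have "(\<lambda>n. d 0 * trunc 0 n z) \<longlonglongrightarrow> 0" by simp
  moreover have "(\<lambda>n. d 0 * trunc 0 n z) \<longlonglongrightarrow> d 0 * tail_det 0 z" by (intro tendsto_intros trunc_tendsto)
  ultimately have "d 0 * tail_det 0 z = 0" by (rule LIMSEQ_unique[rotated])
  then show ?thesis using reg[of i] nz by simp
qed

lemma decaying_eigenvector:
  assumes z: "z \<noteq> 0" and zero: "tail_det 0 z = 0"
  shows "l2_shifted jac (1 / z) (decaying z) = (\<lambda>_. 0)"
proof
  fix i
  have "decaying z i - z * mat_apply jac (decaying z) i = 0"
  proof (cases i)
    case 0
    show ?thesis unfolding 0 mat_apply_jac_0 using decaying_rec[of 0 z] zero by (simp add: algebra_simps)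
  next
    case (Suc n)
    show ?thesis unfolding Suc mat_apply_jac_Suc using decaying_rec_Suc[of n z] by (simp add: algebra_simps)
  qed
  then show "l2_shifted jac (1 / z) (decaying z) i = 0" using z by (simp add: l2_shifted_def divide_simps)
qed

lemma decaying_nonzero:
  assumes z: "z \<noteq> 0"
  shows "decaying z \<noteq> (\<lambda>_. 0)"
proof
  assume 0: "decaying z = (\<lambda>_. 0)"
  have "offdiag_prod z n * tail_det (Suc n) z = 0" for n
    unfolding decaying_def[symmetric] by (simp add: 0)
  then have "tail_det (Suc n) z = 0" for n
    using offdiag_prod_nonzero[OF z, of n] by (metis mult_eq_0_iff)
  then show False using LIMSEQ_Suc[OF tail_det_tendsto_1[of z]] by (simp add: LIMSEQ_const_iff)
qed

lemma spectrum_iff: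
  assumes z: "z \<noteq> 0"
  shows "1 / z \<in> l2_spectrum jac \<longleftrightarrow> tail_det 0 z = 0"
proof
  assume zero: "tail_det 0 z = 0"
  have "l2_shifted jac (1 / z) (\<lambda>_. 0) = (\<lambda>_. 0)" by (simp add: l2_shifted_def mat_apply_def)
  moreover have "(\<lambda>_. 0) \<in> l2" by (simp add: l2_def)
  ultimately have "\<not> inj_on (l2_shifted jac (1 / z)) l2"
    using decaying_eigenvector[OF z zero] decaying_l2[of z] decaying_nonzero[OF z] by (metis inj_on_def)
  then show "1 / z \<in> l2_spectrum jac" by (auto simp: l2_spectrum_def bij_betw_def)
next
  assume spec: "1 / z \<in> l2_spectrum jac"
  show "tail_det 0 z = 0"
  proof (rule ccontr)
    assume nz: "tail_det 0 z \<noteq> 0"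
    let ?A = "l2_shifted jac (1 / z)" and ?G = "mat_apply (green z)"
    obtain C where C: "\<And>n m. cmod (green z n m) \<le> C * exp_weight n m" using green_exp_weight_bound[OF z] by blast
    note G = schur_test_exp_weight(2,3)[OF C]
    have inj: "inj_on ?A l2"
    proof (rule inj_onI)
      fix u v assume u: "u \<in> l2" "v \<in> l2" and eq: "?A u = ?A v"
      define d where "d n = u n - 1 * v n" for n
      have "d \<in> l2" unfolding d_def by (intro l2_lincomb u)
      moreover have "mat_apply jac d i = 1 / z * d i" for i
      proof -
        have lin: "mat_apply jac d i = mat_apply jac u i - mat_apply jac v i"
          by (cases i) (simp_all add: mat_apply_jac_0 mat_apply_jac_Suc d_def algebra_simps)
        have "mat_apply jac u i - mat_apply jac v i = 1 / z * u i - 1 / z * v i"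
          using fun_cong[OF eq, of i] by (simp add: l2_shifted_def algebra_simps)
        then show ?thesis unfolding lin d_def by (simp add: diff_divide_distrib)
      qed
      ultimately have "d i = 0" for i by (rule jac_eigenvector_eq_0[OF z nz])
      then show "u = v" by (auto simp: d_def fun_eq_iff)
    qed
    have "f \<in> ?A ` l2" if "f \<in> l2" for f
      using green_right_inverse[OF z nz that] G(1)[OF that] by (metis imageI)
    then have bij: "bij_betw ?A l2 l2"
      using inj l2_shifted_jac_l2 by (auto simp: bij_betw_def)
    have "l2_norm u \<le> C * 3 * l2_norm (?A u)" if u: "u \<in> l2" for u
    proof -
      have Au: "?A u \<in> l2" by (rule l2_shifted_jac_l2[OF u])
      have "?A (?G (?A u)) = ?A u" by (rule green_right_inverse[OF z nz Au])
      then have "?G (?A u) = u" using inj G(1)[OF Au] u by (auto dest: inj_onD)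
      then show ?thesis using G(2)[OF Au] by simp
    qed
    then show False using spec bij by (auto simp: l2_spectrum_def)
  qed
qed

end

section \<open>The polynomials $P_n$\<close>

lemma quad_inverse_bigo: "(\<lambda>n. 1 / quad \<mu> \<nu> \<alpha> n) \<in> O(\<lambda>n. 1 / real n ^ 2)"
  unfolding quad_def by real_asymp

lemma summable_abs_bigo:
  fixes f :: "nat \<Rightarrow> real"
  assumes "f \<in> O(\<lambda>n. 1 / real n ^ 2)"
  shows "summable (\<lambda>n. \<bar>f n\<bar>)"
proof (rule summable_comparison_test_bigo)
  show "summable (\<lambda>n. norm (1 / real n ^ 2))"
    using inverse_power_summable[of 2] by (simp add: inverse_eq_divide)
  show "(\<lambda>n. \<bar>f n\<bar>) \<in> O(\<lambda>n. 1 / real n ^ 2)" using assms by simp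
qed

lemma bigo_cmult:
  fixes f g :: "nat \<Rightarrow> real"
  assumes "f \<in> O(g)"
  shows "(\<lambda>n. c * f n) \<in> O(g)"
  using assms by (cases "c = 0") simp_all

lemma b_bigo: "b \<mu> \<nu> \<alpha> \<theta> \<in> O(\<lambda>n. 1 / real n ^ 2)"
proof -
  let ?r = "\<lambda>n. 1 / ((2 * real n + \<mu> + \<nu>) * (2 * real n + \<mu> + \<nu> + 2))"
  have "?r \<in> O(\<lambda>_. 1)" by real_asymp
  then have "(\<lambda>n. 1 / quad \<mu> \<nu> \<alpha> n * ?r n) \<in> O(\<lambda>n. 1 / real n ^ 2 * 1)"
    by (intro landau_o.big.mult quad_inverse_bigo)
  then have r: "(\<lambda>n. 1 / quad \<mu> \<nu> \<alpha> n * ?r n) \<in> O(\<lambda>n. 1 / real n ^ 2)"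
    unfolding mult_1_right .
  have sum: "(\<lambda>n. cos \<theta> / sin \<theta> * (1 / quad \<mu> \<nu> \<alpha> n) + (\<mu>\<^sup>2 - \<nu>\<^sup>2) / sin \<theta> * (1 / quad \<mu> \<nu> \<alpha> n * ?r n)) \<in> O(\<lambda>n. 1 / real n ^ 2)"
    by (rule sum_in_bigo(1)[OF bigo_cmult[OF quad_inverse_bigo] bigo_cmult[OF r]])
  have "\<forall>\<^sub>F n in sequentially. cos \<theta> / sin \<theta> * (1 / quad \<mu> \<nu> \<alpha> n) + (\<mu>\<^sup>2 - \<nu>\<^sup>2) / sin \<theta> * (1 / quad \<mu> \<nu> \<alpha> n * ?r n) = b \<mu> \<nu> \<alpha> \<theta> n"
    using eventually_gt_at_top[of 0]
  proof eventually_elim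
    case (elim n)
    have "c / s * (1 / q) + d / s * (1 / q * (1 / x)) = 1 / (s * q) * (c + d / x)" for c s q d x :: real
      by (simp add: distrib_left)
    then show ?case unfolding b_def if_not_P[OF less_imp_neq[OF elim, symmetric]] .
  qed
  from landau_o.big.in_cong[OF this] sum show ?thesis by (rule iffD1)
qed

text \<open>
  $a_n^2$ without the constant $4/\sin^2\theta$ and without natural subtraction: a quotient of
  polynomials in \<open>n\<close> with positive leading coefficients, so its growth and its eventual sign do not
  depend on the parameters.
\<close>

definition a_sq_main :: "real \<Rightarrow> real \<Rightarrow> real \<Rightarrow> nat \<Rightarrow> real" where
  "a_sq_main \<mu> \<nu> \<alpha> n =
     real n * (real n + \<mu>) * (real n + \<nu>) * (real n + \<mu> + \<nu>) /
       (((real n + (\<mu> + \<nu> + 1) / 2)\<^sup>2 + \<alpha>) * ((real n - 1 + (\<mu> + \<nu> + 1) / 2)\<^sup>2 + \<alpha>) *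
        (2 * real n + \<mu> + \<nu> + 1) * (2 * real n + \<mu> + \<nu>)\<^sup>2 * (2 * real n + \<mu> + \<nu> - 1))"

lemma a_sq_eventually_eq:
  "\<forall>\<^sub>F n in sequentially. 4 / (sin \<theta>)\<^sup>2 * a_sq_main \<mu> \<nu> \<alpha> n = a_sq \<mu> \<nu> \<alpha> \<theta> n"
  using eventually_gt_at_top[of 1]
proof eventually_elim
  case (elim n)
  then have "real (n - 1) = real n - 1" by simp
  then have "a_sq \<mu> \<nu> \<alpha> \<theta> n = 4 * (real n * (real n + \<mu>) * (real n + \<nu>) * (real n + \<mu> + \<nu>)) /
      ((sin \<theta>)\<^sup>2 * (((real n + (\<mu> + \<nu> + 1) / 2)\<^sup>2 + \<alpha>) * ((real n - 1 + (\<mu> + \<nu> + 1) / 2)\<^sup>2 + \<alpha>) *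
        (2 * real n + \<mu> + \<nu> + 1) * (2 * real n + \<mu> + \<nu>)\<^sup>2 * (2 * real n + \<mu> + \<nu> - 1)))"
    using elim unfolding a_sq_def quad_def if_not_P[OF less_imp_neq[OF elim, symmetric]]
    by (simp only: mult.assoc)
  then show ?case unfolding a_sq_main_def times_divide_times_eq by (rule sym)
qed

lemma a_sq_bigo: "a_sq \<mu> \<nu> \<alpha> \<theta> \<in> O(\<lambda>n. 1 / real n ^ 2)"
proof -
  have "a_sq_main \<mu> \<nu> \<alpha> \<in> O(\<lambda>n. 1 / real n ^ 2)"
    unfolding a_sq_main_def[abs_def] by real_asymp
  then have "(\<lambda>n. 4 / (sin \<theta>)\<^sup>2 * a_sq_main \<mu> \<nu> \<alpha> n) \<in> O(\<lambda>n. 1 / real n ^ 2)"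
    by (rule bigo_cmult)
  with landau_o.big.in_cong[OF a_sq_eventually_eq] show ?thesis by (rule iffD1)
qed

text \<open>
  Only finitely many of the factors \<open>quad\<close> can be negative, however negative \<open>\<alpha>\<close> is.
\<close>

lemma a_sq_eventually_pos:
  assumes "sin \<theta> \<noteq> 0"
  shows "\<forall>\<^sub>F n in sequentially. a_sq \<mu> \<nu> \<alpha> \<theta> n > 0"
proof -
  have "\<forall>\<^sub>F n in sequentially. a_sq_main \<mu> \<nu> \<alpha> n > 0"
    unfolding a_sq_main_def by real_asymp
  with a_sq_eventually_eq[of \<theta> \<mu> \<nu> \<alpha>] show ?thesis
  proof eventually_elim
    case (elim n)
    have "0 < 4 / (sin \<theta>)\<^sup>2 * a_sq_main \<mu> \<nu> \<alpha> n" using elim assms by (intro mult_pos_pos) auto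
    then show ?case unfolding elim(1) .
  qed
qed

lemma a_sq_nonzero:
  assumes "\<mu> > -1" "\<nu> > -1" "sin \<theta> \<noteq> 0" and q: "\<And>n. quad \<mu> \<nu> \<alpha> n \<noteq> 0"
  shows "a_sq \<mu> \<nu> \<alpha> \<theta> (Suc n) \<noteq> 0"
proof (cases n)
  case 0
  then show ?thesis using assms q[of 0] q[of 1] by (simp add: a_sq_def)
next
  case (Suc m)
  define N where "N = real (Suc n)"
  have "N \<ge> 2" using Suc by (simp add: N_def)
  then have nz: "N \<noteq> 0" "N + \<mu> \<noteq> 0" "N + \<nu> \<noteq> 0" "N + \<mu> + \<nu> \<noteq> 0"
    "2 * N + \<mu> + \<nu> + 1 \<noteq> 0" "2 * N + \<mu> + \<nu> \<noteq> 0" "2 * N + \<mu> + \<nu> - 1 \<noteq> 0"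
    using assms(1,2) by auto
  have "Suc n \<noteq> 1" using Suc by simp
  then show ?thesis
    unfolding a_sq_def N_def[symmetric] using nz assms(3) q by (simp only: if_False divide_eq_0_iff mult_eq_0_iff power_eq_0_iff) simp
qed

lemma jacobi_matrix_ab:
  assumes "\<mu> > -1" "\<nu> > -1" "sin \<theta> \<noteq> 0" "\<And>n. quad \<mu> \<nu> \<alpha> n \<noteq> 0"
  shows "jacobi_matrix (b \<mu> \<nu> \<alpha> \<theta>) (a_sq \<mu> \<nu> \<alpha> \<theta>) (a \<mu> \<nu> \<alpha> \<theta>)"
proof
  show "a_sq \<mu> \<nu> \<alpha> \<theta> (Suc n) \<noteq> 0" for n by (rule a_sq_nonzero[OF assms])
  show "(a \<mu> \<nu> \<alpha> \<theta> n)\<^sup>2 = of_real (a_sq \<mu> \<nu> \<alpha> \<theta> n)" for n by (simp add: a_def)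
  show "summable (\<lambda>n. \<bar>b \<mu> \<nu> \<alpha> \<theta> n\<bar>)" by (rule summable_abs_bigo[OF b_bigo])
  show "summable (\<lambda>n. \<bar>a_sq \<mu> \<nu> \<alpha> \<theta> n\<bar>)" by (rule summable_abs_bigo[OF a_sq_bigo])
qed

lemma coeff_P_eq_1:
  assumes "\<mu> > -1" "\<nu> > -1" "sin \<theta> \<noteq> 0" "\<And>n. quad \<mu> \<nu> \<alpha> n \<noteq> 0"
  shows "coeff (P \<mu> \<nu> \<alpha> \<theta> n) n = 1"
proof -
  have up: "H_up \<mu> \<nu> k \<noteq> 0" for k using H_up_pos[OF assms(1,2), of k] by simp
  have nz: "coeff (H \<mu> \<nu> \<alpha> \<theta> n) n \<noteq> 0"
    using H_deg_lc[of \<mu> \<nu> \<alpha> \<theta> n] assms(3,4) up by simp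
  then have "degree (H \<mu> \<nu> \<alpha> \<theta> n) = n"
    using H_deg_lc[of \<mu> \<nu> \<alpha> \<theta> n] le_degree[OF nz] by simp
  then show ?thesis using nz by (simp add: P_def)
qed

text \<open>
  Both sides satisfy the same recurrence once that of $P_n$ at $1/z$ is multiplied by $z^n$. At
  \<open>z = 0\<close>, where \<open>reversed\<close> reads off a coefficient, monicity gives \<open>1\<close>.
\<close>

lemma reversed_P_eq_trunc:
  assumes "\<mu> > -1" "\<nu> > -1" "sin \<theta> \<noteq> 0" and q: "\<And>n. quad \<mu> \<nu> \<alpha> n \<noteq> 0"
  shows "reversed n (P \<mu> \<nu> \<alpha> \<theta> n) z = jacobi_coeffs.trunc (b \<mu> \<nu> \<alpha> \<theta>) (a_sq \<mu> \<nu> \<alpha> \<theta>) 0 n z"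
proof -
  interpret jacobi_matrix "b \<mu> \<nu> \<alpha> \<theta>" "a_sq \<mu> \<nu> \<alpha> \<theta>" "a \<mu> \<nu> \<alpha> \<theta>"
    by (rule jacobi_matrix_ab[OF assms])
  show ?thesis
  proof (cases "z = 0")
    case True
    then show ?thesis using coeff_P_eq_1[OF assms] by (simp add: reversed_def)
  next
    case False
    note rec = P_recurrence[OF assms(1,2,3) q, where z="1 / z"]
    have P0: "poly (P \<mu> \<nu> \<alpha> \<theta> 0) w = 1" for w by (simp add: P_def)
    have "z ^ n * poly (P \<mu> \<nu> \<alpha> \<theta> n) (1 / z) = trunc 0 n z"
    proof (induction n rule: induct_nat_012)
      case 0
      then show ?case by (simp add: P0)
    next
      case 1
      have p: "poly (P \<mu> \<nu> \<alpha> \<theta> (Suc 0)) (1 / z) = 1 / z - of_real (b \<mu> \<nu> \<alpha> \<theta> 0)"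
        using rec(1) unfolding P0 by (simp add: algebra_simps)
      show ?case unfolding One_nat_def p using False by (simp add: right_diff_distrib)
    next
      case (ge2 n)
      have p: "poly (P \<mu> \<nu> \<alpha> \<theta> (Suc (Suc n))) (1 / z) = (1 / z - of_real (b \<mu> \<nu> \<alpha> \<theta> (Suc n))) * poly (P \<mu> \<nu> \<alpha> \<theta> (Suc n)) (1 / z)
         - of_real (a_sq \<mu> \<nu> \<alpha> \<theta> (Suc n)) * poly (P \<mu> \<nu> \<alpha> \<theta> n) (1 / z)"
        using rec(2)[of n] by (simp add: algebra_simps)
      have "z ^ Suc (Suc n) * poly (P \<mu> \<nu> \<alpha> \<theta> (Suc (Suc n))) (1 / z) =
          (1 - of_real (b \<mu> \<nu> \<alpha> \<theta> (Suc n)) * z) * (z ^ Suc n * poly (P \<mu> \<nu> \<alpha> \<theta> (Suc n)) (1 / z))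
          - of_real (a_sq \<mu> \<nu> \<alpha> \<theta> (Suc n)) * z\<^sup>2 * (z ^ n * poly (P \<mu> \<nu> \<alpha> \<theta> n) (1 / z))"
        unfolding p using False by (simp add: field_simps power2_eq_square)
      then show ?case unfolding ge2 by simp
    qed
    then show ?thesis using False by (simp add: reversed_def)
  qed
qed

theorem theorem1:
  fixes \<mu> \<nu> \<alpha> \<theta> :: real
  assumes "\<mu> > -1" and "\<nu> > -1" and "0 \<le> \<theta>" and "\<theta> \<le> pi"
    and "sin \<theta> \<noteq> 0" and "\<And>n. (real n + (\<mu> + \<nu> + 1) / 2)\<^sup>2 + \<alpha> \<noteq> 0"
  shows "\<exists>Q :: complex \<Rightarrow> complex.
           Q holomorphic_on UNIV \<and>
           (\<forall>K. compact K \<longrightarrow>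
              uniform_limit K (\<lambda>n z. reversed n (P \<mu> \<nu> \<alpha> \<theta> n) z) Q sequentially) \<and>
           infinite {z. Q z = 0} \<and>
           {z. Q z = 0} = {1 / x | x. x \<in> l2_spectrum (J \<mu> \<nu> \<alpha> \<theta>) \<and> x \<noteq> 0}"
proof -
  have q: "quad \<mu> \<nu> \<alpha> n \<noteq> 0" for n using assms(6)[of n] by (simp add: quad_def)
  note A = assms(1,2,5) q
  interpret M: jacobi_matrix "b \<mu> \<nu> \<alpha> \<theta>" "a_sq \<mu> \<nu> \<alpha> \<theta>" "a \<mu> \<nu> \<alpha> \<theta>"
    by (rule jacobi_matrix_ab[OF A])
  have jac: "M.jac = J \<mu> \<nu> \<alpha> \<theta>" by (intro ext) (simp add: M.jac_def J_def)
  have lim: "uniform_limit K (\<lambda>n z. reversed n (P \<mu> \<nu> \<alpha> \<theta> n) z) (M.tail_det 0) sequentially" if K: "compact K" for K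
  proof -
    obtain r where "\<forall>z\<in>K. cmod z \<le> r" using compact_imp_bounded[OF K] by (auto simp: bounded_iff)
    then have "K \<subseteq> cball 0 r" by auto
    then show ?thesis
      unfolding reversed_P_eq_trunc[OF A] by (rule uniform_limit_on_subset[OF M.uniform_limit_trunc])
  qed
  have zeros: "{z. M.tail_det 0 z = 0} = {1 / x | x. x \<in> l2_spectrum (J \<mu> \<nu> \<alpha> \<theta>) \<and> x \<noteq> 0}"
  proof (intro set_eqI iffI)
    fix z assume z: "z \<in> {z. M.tail_det 0 z = 0}"
    then have "z \<noteq> 0" by auto
    with z M.spectrum_iff[of z] show "z \<in> {1 / x | x. x \<in> l2_spectrum (J \<mu> \<nu> \<alpha> \<theta>) \<and> x \<noteq> 0}"
      unfolding jac by (intro CollectI exI[of _ "1 / z"]) auto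
  next
    fix z assume "z \<in> {1 / x | x. x \<in> l2_spectrum (J \<mu> \<nu> \<alpha> \<theta>) \<and> x \<noteq> 0}"
    then obtain x where "z = 1 / x" "x \<in> l2_spectrum (J \<mu> \<nu> \<alpha> \<theta>)" "x \<noteq> 0" by blast
    then show "z \<in> {z. M.tail_det 0 z = 0}" using M.spectrum_iff[of z] unfolding jac by simp
  qed
  show ?thesis
    using M.holomorphic_tail_det[of 0 UNIV] lim M.infinite_zeros_tail_det[OF a_sq_eventually_pos[OF assms(5)]] zeros by blast
qed

end
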